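(* Assume that the solution $u$ belongs to $\mathcal A^{\eta,t}_G$ for some $\eta>0$ and $t\in(0,d]$. Then there exists a constant $C>1$ such that the cardinality of the set $\Lambda_n$ of the active degrees of freedom produced by C-ADFOUR satisfies the bound $$|\Lambda_n|\le\kappa\,\frac{\omega_d}{\eta^{d/t}}\left(\log\frac{\|u\|_{\mathcal A^{\eta,t}_G}}{\|u-u_n\|}+\log C\right)^{d/t}\qquad\forall\,n\ge0.$$
   Context: Let $d\ge1$, $\Omega=(0,2\pi)^d$, $\phi_k(x)=(2\pi)^{-d/2}e^{ik\cdot x}$ for $k\in\mathbb Z^d$, $\hat v_k=(v,\phi_k)_{L^2(\Omega)}$. $V=H^1_p(\Omega)$: $H^1$ functions $2\pi$-periodic in each direction, norm $\|v\|^2=\sum_k(1+|k|^2)|\hat v_k|^2$ ($|k|$ Euclidean). $H^{-1}_p(\Omega)$ is its (anti)dual, $\hat f_k=\langle f,\phi_k\rangle$, $\|f\|^2=\sum_k(1+|k|^2)^{-1}|\hat f_k|^2$ (same symbol for both norms). For $\Lambda\subset\mathbb Z^d$, $P_\Lambda$ keeps only the Fourier coefficients with index in $\Lambda$; $V_\Lambda=\mathrm{span}\{\phi_k:k\in\Lambda\}$; $|\Lambda|$ is the cardinality. $Lu=-\nabla\cdot(\nu\nabla u)+\sigma u$ with sufficiently smooth real ($2\pi$-periodic) coefficients, $0<\nu_*\le\nu\le\nu^*<\infty$, $0<\sigma_*\le\sigma\le\sigma^*<\infty$; $\alpha_*=\min(\nu_*,\sigma_* )$, $\alpha^*=\max(\nu^*,\sigma^*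 )$; $a(u,v)=\int_\Omega\nu\nabla u\cdot\nabla\bar v+\int_\Omega\sigma u\bar v$; $f\in H^{-1}_p(\Omega)$; $u\in V$ solves $a(u,v)=\langle f,v\rangle$ for all $v\in V$. For finite $\Lambda$, $u_\Lambda\in V_\Lambda$ solves $a(u_\Lambda,v)=\langle f,v\rangle$ for all $v\in V_\Lambda$. Residual: $r(w)=f-Lw$. DÖRFLER$(r,\theta)$ returns a finite set $\Lambda^*\subset\mathbb Z^d$ of minimal cardinality with $\|P_{\Lambda^*}r\|\ge\theta\|r\|$. COARSE$(w,\epsilon)$, for $w\in V_{\Lambda^*}$ with $\Lambda^*$ finite and $\|u-w\|\le\epsilon$, returns a set $\Lambda\subseteq\Lambda^*$ of minimal cardinality such that $\|w-P_\Lambda w\|\le2\epsilon$. Algorithm C-ADFOUR$(\theta,tol)$, $\theta\in(0,1)$, $tol\in[0,1)$: set $\Lambda_0=\emptyset$, $u_0=0$, $r_0=f$. For $n=0,1,2,\dots$ (outer loop): set $\Lambda_{n,0}=\Lambda_n$, $r_{n,0}=r_n$; inner loop, for $k=0,1,\dots$: $\partial\Lambda_{n,k}=$ DÖRFLER$(r_{n,k},\theta)$, $\Lambda_{n,k+1}=\Lambda_{n,k}\cup\partial\Lambda_{n,k}$, $u_{n,k+1}=u_{\Lambda_{n,k+1}}$, $r_{n,k+1}=r(u_{n,k+1})$, repeating while $\|r_{n,k+1}\|>\sqrt{1-\theta^2}\,\|r_n\|$. At the exit of the inner loop: $\Lambda_{n+1}=$ COARSE$\big(u_{n,k+1},\frac1{\alpha_*}\|r_{n,k+1}\|\big)$,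 $u_{n+1}=u_{\Lambda_{n+1}}$, $r_{n+1}=r(u_{n+1})$; continue the outer loop while $\|r_{n+1}\|>tol$. $\omega_d$ is the measure of the Euclidean unit ball in $\mathbb R^d$; $E_N(v)=\inf_{|\Lambda|=N}\|v-P_\Lambda v\|$ ($E_0(v)=\|v\|$). Exponential class: $\mathcal A^{\eta,t}_G=\{v\in V:\ \|v\|_{\mathcal A^{\eta,t}_G}:=\sup_{N\ge0}E_N(v)\exp(\eta\,\omega_d^{-t/d}N^{t/d})<\infty\}$. $\kappa>1$ is a fixed constant (slightly larger than $1$) used to absorb the additive $1$ in bounds of the form $N\le\frac{\omega_d}{\eta^{d/t}}(\log(\cdot))^{d/t}+1$. If $u_n=u$ the right-hand side of the bound is read as $+\infty$. *)

theory Defs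
  imports "HOL-Analysis.Analysis"
begin

section \<open>Periodic functions and Fourier coefficients\<close>

text \<open>
  The dimension is \<open>d = CARD('d)\<close>. Points are of type \<open>real ^ 'd\<close>, frequencies of type
  \<open>int ^ 'd\<close>. Elements of function spaces are represented by functions on the whole of
  \<open>real ^ 'd\<close> that are periodic everywhere; almost-everywhere equal functions are not
  identified, so the norm below is only a seminorm on representatives.
\<close>

definition Omega :: "(real ^ 'd::finite) set" where
  "Omega = box 0 (\<chi> j. 2 * pi)"

definition periodic :: "(real ^ 'd::finite \<Rightarrow> 'b) \<Rightarrow> bool" where
  "periodic v \<longleftrightarrow> (\<forall>j x. v (x + (2 * pi) *\<^sub>R axis j 1) = v x)"

definition freq :: "int ^ 'd::finite \<Rightarrow> real ^ 'd" where
  "freq k = (\<chi> j. real_of_int (k $ j))"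

definition phi :: "int ^ 'd::finite \<Rightarrow> real ^ 'd \<Rightarrow> complex" where
  "phi k x = complex_of_real ((2 * pi) powr (- real CARD('d) / 2)) * exp (\<i> * complex_of_real (freq k \<bullet> x))"

definition fourier :: "(real ^ 'd::finite \<Rightarrow> complex) \<Rightarrow> int ^ 'd \<Rightarrow> complex" where
  "fourier v k = set_lebesgue_integral lebesgue Omega (\<lambda>x. v x * cnj (phi k x))"

definition L2 :: "(real ^ 'd::finite \<Rightarrow> complex) set" where
  "L2 = {v. set_borel_measurable lebesgue Omega v \<and>
            set_integrable lebesgue Omega (\<lambda>x. (cmod (v x))\<^sup>2)}"


section \<open>Smoothness and weak gradients on the torus\<close>

definition partial :: "'d::finite \<Rightarrow> (real ^ 'd \<Rightarrow> 'b::real_normed_vector) \<Rightarrow> real ^ 'd \<Rightarrow> 'b" where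
  "partial j f x = frechet_derivative f (at x) (axis j 1)"

primrec C_k :: "nat \<Rightarrow> (real ^ 'd::finite \<Rightarrow> 'b::real_normed_vector) \<Rightarrow> bool" where
  "C_k 0 f \<longleftrightarrow> continuous_on UNIV f"
| "C_k (Suc m) f \<longleftrightarrow> (\<forall>x. f differentiable (at x)) \<and> (\<forall>j. C_k m (partial j f))"

definition test_function :: "(real ^ 'd::finite \<Rightarrow> complex) \<Rightarrow> bool" where
  "test_function p \<longleftrightarrow> periodic p \<and> (\<forall>m. C_k m p)"

text \<open>
  Since the test functions are periodic rather than compactly supported in \<open>Omega\<close>, no boundary
  terms are lost: a jump of \<open>v\<close> across opposite faces of \<open>Omega\<close> is excluded.
\<close>

definition weak_gradient :: "(real ^ 'd::finite \<Rightarrow> complex) \<Rightarrow> (real ^ 'd \<Rightarrow> complex ^ 'd) \<Rightarrow> bool" where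
  "weak_gradient v g \<longleftrightarrow>
     (\<forall>j. (\<lambda>x. g x $ j) \<in> L2 \<and>
          (\<forall>p. test_function p \<longrightarrow>
             set_lebesgue_integral lebesgue Omega (\<lambda>x. v x * partial j p x) =
             - set_lebesgue_integral lebesgue Omega (\<lambda>x. g x $ j * p x)))"

text \<open>The weak gradient is unique up to null sets, which integrals do not see.\<close>

definition grad :: "(real ^ 'd::finite \<Rightarrow> complex) \<Rightarrow> real ^ 'd \<Rightarrow> complex ^ 'd" where
  "grad v = (SOME g. weak_gradient v g)"


section \<open>The periodic Sobolev space and its antidual\<close>

definition H1p :: "(real ^ 'd::finite \<Rightarrow> complex) set" where
  "H1p = {v. periodic v \<and> v \<in> L2 \<and> (\<exists>g. weak_gradient v g)}"

definition H1_norm :: "(real ^ 'd::finite \<Rightarrow> complex) \<Rightarrow> real" where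
  "H1_norm v = sqrt (\<Sum>\<^sub>\<infinity>k. (1 + (norm (freq k))\<^sup>2) * (cmod (fourier v k))\<^sup>2)"

text \<open>
  Functionals are given as functions on all representatives; only their values on \<open>H1p\<close> matter.
  Boundedness with respect to the seminorm forces them to respect almost-everywhere equality.
\<close>

definition Hm1p :: "((real ^ 'd::finite \<Rightarrow> complex) \<Rightarrow> complex) set" where
  "Hm1p = {f. (\<forall>v\<in>H1p. \<forall>w\<in>H1p. f (\<lambda>x. v x + w x) = f v + f w) \<and>
              (\<forall>c. \<forall>v\<in>H1p. f (\<lambda>x. c * v x) = cnj c * f v) \<and>
              (\<exists>B. \<forall>v\<in>H1p. cmod (f v) \<le> B * H1_norm v)}"

definition dual_fourier :: "((real ^ 'd::finite \<Rightarrow> complex) \<Rightarrow> complex) \<Rightarrow> int ^ 'd \<Rightarrow> complex" where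
  "dual_fourier f k = f (phi k)"

definition Hm1_norm :: "((real ^ 'd::finite \<Rightarrow> complex) \<Rightarrow> complex) \<Rightarrow> real" where
  "Hm1_norm f = sqrt (\<Sum>\<^sub>\<infinity>k. (cmod (dual_fourier f k))\<^sup>2 / (1 + (norm (freq k))\<^sup>2))"

text \<open>The two projections are meant for finite index sets only.\<close>

definition proj :: "(int ^ 'd::finite) set \<Rightarrow> (real ^ 'd \<Rightarrow> complex) \<Rightarrow> real ^ 'd \<Rightarrow> complex" where
  "proj \<Lambda> v = (\<lambda>x. \<Sum>k\<in>\<Lambda>. fourier v k * phi k x)"

definition dual_proj :: "(int ^ 'd::finite) set \<Rightarrow> ((real ^ 'd \<Rightarrow> complex) \<Rightarrow> complex) \<Rightarrow>
    (real ^ 'd \<Rightarrow> complex) \<Rightarrow> complex" where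
  "dual_proj \<Lambda> f = (\<lambda>v. \<Sum>k\<in>\<Lambda>. dual_fourier f k * cnj (fourier v k))"

definition trig_span :: "(int ^ 'd::finite) set \<Rightarrow> (real ^ 'd \<Rightarrow> complex) set" where
  "trig_span \<Lambda> = {v. \<exists>F c. finite F \<and> F \<subseteq> \<Lambda> \<and> v = (\<lambda>x. \<Sum>k\<in>F. c k * phi k x)}"


section \<open>The boundary value problem and its Galerkin approximation\<close>

definition bilin :: "(real ^ 'd::finite \<Rightarrow> real) \<Rightarrow> (real ^ 'd \<Rightarrow> real) \<Rightarrow>
    (real ^ 'd \<Rightarrow> complex) \<Rightarrow> (real ^ 'd \<Rightarrow> complex) \<Rightarrow> complex" where
  "bilin \<nu> \<sigma> u v =
     set_lebesgue_integral lebesgue Omega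
       (\<lambda>x. complex_of_real (\<nu> x) * (\<Sum>j\<in>UNIV. grad u x $ j * cnj (grad v x $ j))) +
     set_lebesgue_integral lebesgue Omega (\<lambda>x. complex_of_real (\<sigma> x) * u x * cnj (v x))"

text \<open>\<open>- div (\<nu> grad w) + \<sigma> w\<close> as an element of the antidual, i.e. in weak form.\<close>

definition oper :: "(real ^ 'd::finite \<Rightarrow> real) \<Rightarrow> (real ^ 'd \<Rightarrow> real) \<Rightarrow>
    (real ^ 'd \<Rightarrow> complex) \<Rightarrow> (real ^ 'd \<Rightarrow> complex) \<Rightarrow> complex" where
  "oper \<nu> \<sigma> w = (\<lambda>v. bilin \<nu> \<sigma> w v)"

definition residual :: "(real ^ 'd::finite \<Rightarrow> real) \<Rightarrow> (real ^ 'd \<Rightarrow> real) \<Rightarrow>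
    ((real ^ 'd \<Rightarrow> complex) \<Rightarrow> complex) \<Rightarrow> (real ^ 'd \<Rightarrow> complex) \<Rightarrow> (real ^ 'd \<Rightarrow> complex) \<Rightarrow> complex" where
  "residual \<nu> \<sigma> f w = (\<lambda>v. f v - oper \<nu> \<sigma> w v)"

definition weak_solution :: "(real ^ 'd::finite \<Rightarrow> real) \<Rightarrow> (real ^ 'd \<Rightarrow> real) \<Rightarrow>
    ((real ^ 'd \<Rightarrow> complex) \<Rightarrow> complex) \<Rightarrow> (real ^ 'd \<Rightarrow> complex) \<Rightarrow> bool" where
  "weak_solution \<nu> \<sigma> f u \<longleftrightarrow> u \<in> H1p \<and> (\<forall>v\<in>H1p. bilin \<nu> \<sigma> u v = f v)"

definition galerkin :: "(real ^ 'd::finite \<Rightarrow> real) \<Rightarrow> (real ^ 'd \<Rightarrow> real) \<Rightarrow>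
    ((real ^ 'd \<Rightarrow> complex) \<Rightarrow> complex) \<Rightarrow> (int ^ 'd) set \<Rightarrow> (real ^ 'd \<Rightarrow> complex) \<Rightarrow> bool" where
  "galerkin \<nu> \<sigma> f \<Lambda> w \<longleftrightarrow> w \<in> trig_span \<Lambda> \<and> (\<forall>v\<in>trig_span \<Lambda>. bilin \<nu> \<sigma> w v = f v)"


section \<open>The algorithm\<close>

text \<open>
  The sets returned by the two subroutines need not be unique, so both are modelled as
  relations between input and admissible output.
\<close>

definition doerfler :: "((real ^ 'd::finite \<Rightarrow> complex) \<Rightarrow> complex) \<Rightarrow> real \<Rightarrow> (int ^ 'd) set \<Rightarrow> bool" where
  "doerfler r \<theta> \<Lambda> \<longleftrightarrow>
     finite \<Lambda> \<and> Hm1_norm (dual_proj \<Lambda> r) \<ge> \<theta> * Hm1_norm r \<and>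
     (\<forall>\<Lambda>'. finite \<Lambda>' \<and> Hm1_norm (dual_proj \<Lambda>' r) \<ge> \<theta> * Hm1_norm r \<longrightarrow> card \<Lambda> \<le> card \<Lambda>')"

definition coarse :: "(int ^ 'd::finite) set \<Rightarrow> (real ^ 'd \<Rightarrow> complex) \<Rightarrow> real \<Rightarrow> (int ^ 'd) set \<Rightarrow> bool" where
  "coarse \<Lambda>s w \<epsilon> \<Lambda> \<longleftrightarrow>
     finite \<Lambda>s \<and> \<Lambda> \<subseteq> \<Lambda>s \<and> H1_norm (\<lambda>x. w x - proj \<Lambda> w x) \<le> 2 * \<epsilon> \<and>
     (\<forall>\<Lambda>'. \<Lambda>' \<subseteq> \<Lambda>s \<and> H1_norm (\<lambda>x. w x - proj \<Lambda>' w x) \<le> 2 * \<epsilon> \<longrightarrow> card \<Lambda> \<le> card \<Lambda>')"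

text \<open>
  \<open>inner_state \<nu> \<sigma> f \<theta> \<Lambda>n un k \<Lambda> w\<close>: some execution of the inner loop entered with
  \<open>(\<Lambda>n, un)\<close> produces \<open>\<Lambda>\<close> and \<open>w\<close> after \<open>k\<close> passes. The loop test comes after the body,
  hence the first pass is unconditional.
\<close>

inductive inner_state :: "(real ^ 'd::finite \<Rightarrow> real) \<Rightarrow> (real ^ 'd \<Rightarrow> real) \<Rightarrow>
    ((real ^ 'd \<Rightarrow> complex) \<Rightarrow> complex) \<Rightarrow> real \<Rightarrow> (int ^ 'd) set \<Rightarrow> (real ^ 'd \<Rightarrow> complex) \<Rightarrow>
    nat \<Rightarrow> (int ^ 'd) set \<Rightarrow> (real ^ 'd \<Rightarrow> complex) \<Rightarrow> bool"
  for \<nu> \<sigma> f \<theta> \<Lambda>n un where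
  start: "inner_state \<nu> \<sigma> f \<theta> \<Lambda>n un 0 \<Lambda>n un"
| pass: "\<lbrakk>inner_state \<nu> \<sigma> f \<theta> \<Lambda>n un k \<Lambda> w;
          k = 0 \<or> Hm1_norm (residual \<nu> \<sigma> f w) > sqrt (1 - \<theta>\<^sup>2) * Hm1_norm (residual \<nu> \<sigma> f un);
          doerfler (residual \<nu> \<sigma> f w) \<theta> D;
          galerkin \<nu> \<sigma> f (\<Lambda> \<union> D) w'\<rbrakk>
         \<Longrightarrow> inner_state \<nu> \<sigma> f \<theta> \<Lambda>n un (Suc k) (\<Lambda> \<union> D) w'"

text \<open>
  \<open>cadfour \<nu> \<sigma> f \<alpha> \<theta> tol n \<Lambda> w\<close>: some execution produces \<open>\<Lambda>\<close> and \<open>w\<close> as its \<open>n\<close>-th active set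
  and iterate; \<open>\<alpha>\<close> is the coercivity constant. The initial residual is \<open>f\<close> because the iterate
  is \<open>0\<close>. The input condition of the coarsening step is not imposed: coercivity guarantees it.
\<close>

inductive cadfour :: "(real ^ 'd::finite \<Rightarrow> real) \<Rightarrow> (real ^ 'd \<Rightarrow> real) \<Rightarrow>
    ((real ^ 'd \<Rightarrow> complex) \<Rightarrow> complex) \<Rightarrow> real \<Rightarrow> real \<Rightarrow> real \<Rightarrow>
    nat \<Rightarrow> (int ^ 'd) set \<Rightarrow> (real ^ 'd \<Rightarrow> complex) \<Rightarrow> bool"
  for \<nu> \<sigma> f \<alpha> \<theta> tol where
  start: "cadfour \<nu> \<sigma> f \<alpha> \<theta> tol 0 {} (\<lambda>x. 0)"
| pass: "\<lbrakk>cadfour \<nu> \<sigma> f \<alpha> \<theta> tol n \<Lambda>n un;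
          n = 0 \<or> Hm1_norm (residual \<nu> \<sigma> f un) > tol;
          inner_state \<nu> \<sigma> f \<theta> \<Lambda>n un (Suc k) \<Lambda>s w;
          Hm1_norm (residual \<nu> \<sigma> f w) \<le> sqrt (1 - \<theta>\<^sup>2) * Hm1_norm (residual \<nu> \<sigma> f un);
          coarse \<Lambda>s w (1 / \<alpha> * Hm1_norm (residual \<nu> \<sigma> f w)) \<Lambda>;
          galerkin \<nu> \<sigma> f \<Lambda> u'\<rbrakk>
         \<Longrightarrow> cadfour \<nu> \<sigma> f \<alpha> \<theta> tol (Suc n) \<Lambda> u'"


section \<open>The exponential approximation class\<close>

definition omega :: "'d::finite itself \<Rightarrow> real" where
  "omega _ = measure lebesgue (ball (0 :: real ^ 'd) 1)"

definition best_err :: "nat \<Rightarrow> (real ^ 'd::finite \<Rightarrow> complex) \<Rightarrow> real" where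
  "best_err N v = (INF \<Lambda> \<in> {\<Lambda>. finite \<Lambda> \<and> card \<Lambda> = N}. H1_norm (\<lambda>x. v x - proj \<Lambda> v x))"

definition weighted_err :: "real \<Rightarrow> real \<Rightarrow> (real ^ 'd::finite \<Rightarrow> complex) \<Rightarrow> nat \<Rightarrow> real" where
  "weighted_err \<eta> t v N =
     best_err N v * exp (\<eta> * omega TYPE('d) powr (- t / real CARD('d)) * real N powr (t / real CARD('d)))"

definition AG_norm :: "real \<Rightarrow> real \<Rightarrow> (real ^ 'd::finite \<Rightarrow> complex) \<Rightarrow> real" where
  "AG_norm \<eta> t v = (SUP N. weighted_err \<eta> t v N)"

definition AG :: "real \<Rightarrow> real \<Rightarrow> (real ^ 'd::finite \<Rightarrow> complex) set" where
  "AG \<eta> t = {v \<in> H1p. bdd_above (range (weighted_err \<eta> t v))}"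

end

theory Submission
  imports Defs
begin

text \<open>
  The active set \<open>\<Lambda>\<^sub>n\<close> with \<open>n \<ge> 1\<close> comes out of a coarsening step: it is a smallest set that
  keeps the inner Galerkin solution \<open>w\<close> up to \<open>2\<epsilon>\<close>, where \<open>\<epsilon>\<close> is the residual of \<open>w\<close> divided by
  the coercivity constant. Coercivity gives \<open>\<parallel>u - w\<parallel> \<le> \<epsilon>\<close> (\<open>error_le_residual\<close>). Two consequences
  carry the theorem.

  If some \<open>N\<close> frequencies approximate \<open>u\<close> with an error below \<open>\<epsilon>\<close>, the same frequencies approximate
  \<open>w\<close> with an error of at most \<open>2\<epsilon>\<close>, because the complementary projection is a contraction; by
  minimality \<open>\<Lambda>\<^sub>n\<close> has at most \<open>N\<close> elements (\<open>coarse_card_le\<close>). On the other hand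
  \<open>\<parallel>u - P w\<parallel> \<le> 3\<epsilon>\<close> for the projection onto \<open>\<Lambda>\<^sub>n\<close>, so quasi-optimality of the Galerkin solution
  \<open>u\<^sub>n\<close> yields \<open>\<parallel>u - u\<^sub>n\<parallel> \<le> c \<epsilon>\<close> with \<open>c = 3 \<surd>(\<alpha>\<^sup>*/\<alpha>\<^sub>*)\<close> (\<open>coarse_error_le\<close>). Hence the tolerance
  \<open>\<epsilon>\<close> is not much smaller than the final error, and solving the exponential decay of the best
  approximation error for \<open>N\<close> (\<open>AG_number_of_terms\<close>) bounds the cardinality by the claimed
  expression with \<open>\<kappa> = 1\<close> and \<open>C = c\<close>, plus \<open>1\<close> from rounding. The logarithm is nonnegative since
  \<open>\<parallel>u - u\<^sub>n\<parallel> \<le> c \<parallel>u\<parallel> / 3\<close>; enlarging \<open>C\<close> by a factor independent of \<open>f\<close>, \<open>u\<close> and \<open>n\<close> makes the slack \<open>\<kappa> - 1\<close>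
  absorb the additive \<open>1\<close> (\<open>shift_absorbs_one\<close>).

  The norms are defined through Fourier coefficients, the form \<open>a\<close> through weak gradients. The
  bridge between them is Parseval's identity on the cell, which rests on the density of
  trigonometric polynomials: Stone-Weierstrass on the torus, applied to continuous functions that
  approximate a square-integrable function almost everywhere. Parseval also makes weak gradients
  unique almost everywhere, so that an arbitrary choice of gradient is linear up to null sets, and
  it identifies the squared Sobolev norm with the form with unit coefficients.
\<close>

section \<open>Square-integrable functions on the period cell\<close>

abbreviation cell_measure :: "(real ^ 'd::finite) measure" where
  "cell_measure \<equiv> lebesgue_on Omega"

lemma Omega_lmeasurable: "Omega \<in> lmeasurable"
  unfolding Omega_def by simp

lemma Omega_sets [measurable, simp]: "Omega \<in> sets lebesgue"
  using Omega_lmeasurable by auto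

lemma space_cell [simp]: "space cell_measure = Omega"
  by simp

lemma finite_measure_cell: "finite_measure (cell_measure :: (real ^ 'd::finite) measure)"
proof
  have "emeasure lebesgue (Omega :: (real ^ 'd) set) < \<infinity>"
    using Omega_lmeasurable by (auto simp: fmeasurable_def)
  then show "emeasure cell_measure (space (cell_measure :: (real ^ 'd) measure)) \<noteq> \<infinity>"
    by (simp add: emeasure_restrict_space)
qed

lemma set_integral_cell:
  fixes f :: "real ^ 'd::finite \<Rightarrow> complex"
  shows "set_lebesgue_integral lebesgue Omega f = (\<integral>x. f x \<partial>cell_measure)"
  unfolding set_lebesgue_integral_def by (subst integral_restrict_space) auto

lemma L2_iff:
  "v \<in> L2 \<longleftrightarrow> v \<in> borel_measurable cell_measure \<and> integrable cell_measure (\<lambda>x. (cmod (v x))\<^sup>2)"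
  unfolding L2_def set_borel_measurable_def set_integrable_def
  by (simp add: borel_measurable_restrict_space_iff integrable_restrict_space)

lemma L2_measurable: "v \<in> L2 \<Longrightarrow> v \<in> borel_measurable cell_measure"
  by (simp add: L2_iff)

lemma L2_integrable_norm_sq: "v \<in> L2 \<Longrightarrow> integrable cell_measure (\<lambda>x. (cmod (v x))\<^sup>2)"
  by (simp add: L2_iff)

lemma L2_integrable_mult_cnj:
  assumes "u \<in> L2" "v \<in> L2"
  shows "integrable cell_measure (\<lambda>x. u x * cnj (v x))"
proof (rule Bochner_Integration.integrable_bound)
  show "integrable cell_measure (\<lambda>x. (cmod (u x))\<^sup>2 + (cmod (v x))\<^sup>2)"
    using assms by (simp add: L2_iff)
  have [measurable]: "u \<in> borel_measurable cell_measure" "v \<in> borel_measurable cell_measure"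
    using assms by (simp_all add: L2_iff)
  have "cnj \<in> borel_measurable borel"
    by (intro borel_measurable_continuous_onI continuous_intros)
  then have [measurable]: "(\<lambda>x. cnj (v x)) \<in> borel_measurable cell_measure"
    by measurable
  show "(\<lambda>x. u x * cnj (v x)) \<in> borel_measurable cell_measure"
    by measurable
  have "a * b \<le> a\<^sup>2 + b\<^sup>2" if "a \<ge> 0" "b \<ge> 0" for a b :: real
    using that sum_squares_bound[of a b] mult_nonneg_nonneg[of a b] by linarith
  then show "AE x in cell_measure. norm (u x * cnj (v x)) \<le> norm ((cmod (u x))\<^sup>2 + (cmod (v x))\<^sup>2)"
    by (simp add: norm_mult)
qed

lemma norm_add_sq_le: "(norm (a + b))\<^sup>2 \<le> 2 * (norm a)\<^sup>2 + 2 * (norm b)\<^sup>2"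
  for a b :: "'a::real_normed_vector"
proof -
  have "(norm (a + b))\<^sup>2 \<le> (norm a + norm b)\<^sup>2"
    by (simp add: norm_triangle_ineq power_mono)
  also have "\<dots> \<le> 2 * (norm a)\<^sup>2 + 2 * (norm b)\<^sup>2"
    using sum_squares_bound[of "norm a" "norm b"] by (simp add: power2_sum)
  finally show ?thesis .
qed

lemma L2_add:
  assumes "u \<in> L2" "v \<in> L2"
  shows "(\<lambda>x. u x + v x) \<in> L2"
proof -
  have m [measurable]: "u \<in> borel_measurable cell_measure" "v \<in> borel_measurable cell_measure"
    using assms by (simp_all add: L2_iff)
  have "integrable cell_measure (\<lambda>x. (cmod (u x + v x))\<^sup>2)"
  proof (rule Bochner_Integration.integrable_bound)
    show "integrable cell_measure (\<lambda>x. 2 * (cmod (u x))\<^sup>2 + 2 * (cmod (v x))\<^sup>2)"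
      using assms by (simp add: L2_iff)
  qed (auto simp: norm_add_sq_le)
  then show ?thesis
    by (simp add: L2_iff)
qed

lemma L2_cmult:
  assumes "u \<in> L2"
  shows "(\<lambda>x. c * u x) \<in> L2"
  using assms by (auto simp: L2_iff norm_mult power_mult_distrib)

lemma L2_diff:
  assumes "u \<in> L2" "v \<in> L2"
  shows "(\<lambda>x. u x - v x) \<in> L2"
  using L2_add[OF assms(1) L2_cmult[OF assms(2), of "-1"]] by simp

lemma integrable_continuous_cell:
  fixes f :: "real ^ 'd::finite \<Rightarrow> 'b::euclidean_space"
  assumes "continuous_on UNIV f"
  shows "integrable cell_measure f"
proof -
  have "continuous_on (cbox 0 (\<chi> j. 2 * pi)) f"
    using assms continuous_on_subset by blast
  then have "integrable (lebesgue_on (cbox 0 (\<chi> j. 2 * pi))) f"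
    by (rule continuous_imp_integrable)
  then have "f absolutely_integrable_on cbox 0 (\<chi> j. 2 * pi)"
    by (simp add: set_integrable_def integrable_restrict_space)
  then have "f absolutely_integrable_on Omega"
    by (rule set_integrable_subset) (auto simp: Omega_def box_subset_cbox)
  then show ?thesis
    by (simp add: set_integrable_def integrable_restrict_space)
qed

lemma L2_continuous:
  assumes "continuous_on UNIV v"
  shows "v \<in> L2"
proof -
  have "integrable cell_measure v"
    using assms by (rule integrable_continuous_cell)
  moreover have "integrable cell_measure (\<lambda>x. (cmod (v x))\<^sup>2)"
    by (rule integrable_continuous_cell) (intro continuous_intros assms)
  ultimately show ?thesis
    by (auto simp: L2_iff)
qed


section \<open>Periodic functions have derivatives of mean zero\<close>

lemma has_vector_derivative_along_axis:
  fixes q :: "real ^ 'd::finite \<Rightarrow> complex"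
  assumes "\<And>x. q differentiable (at x)"
  shows "((\<lambda>s. q (x + s *\<^sub>R axis j 1)) has_vector_derivative
           partial j q (x + s *\<^sub>R axis j 1)) (at s within S)"
proof -
  let ?y = "x + s *\<^sub>R axis j 1"
  have "(q has_derivative frechet_derivative q (at ?y)) (at ?y)"
    using assms frechet_derivative_works by blast
  moreover have "((\<lambda>s. x + s *\<^sub>R axis j 1) has_derivative (\<lambda>h. h *\<^sub>R axis j 1)) (at s within S)"
    by (auto intro!: derivative_eq_intros)
  ultimately have "((\<lambda>s. q (x + s *\<^sub>R axis j 1)) has_derivative
      (\<lambda>h. frechet_derivative q (at ?y) (h *\<^sub>R axis j 1))) (at s within S)"
    by (rule has_derivative_compose[rotated])
  moreover have "linear (frechet_derivative q (at ?y))"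
    using assms linear_frechet_derivative by blast
  ultimately show ?thesis
    by (simp add: has_vector_derivative_def partial_def linear_cmul)
qed

text \<open>
  Cutting the translated cell along the face \<open>x\<^sub>j = 2\<pi>\<close> and moving the protruding slab back by one
  period reassembles the original cell.
\<close>

lemma integral_cell_translate:
  fixes q :: "real ^ 'd::finite \<Rightarrow> complex"
  assumes per: "periodic q" and cont: "continuous_on UNIV q" and s: "0 \<le> s" "s \<le> 2 * pi"
  shows "(\<integral>x. q (x + s *\<^sub>R axis j 1) \<partial>cell_measure) = (\<integral>x. q x \<partial>cell_measure)"
proof -
  define lo :: "real \<Rightarrow> real ^ 'd" where "lo r = (\<chi> i. if i = j then r else 0)" for r
  define hi :: "real \<Rightarrow> real ^ 'd" where "hi r = (\<chi> i. if i = j then r else 2 * pi)" for r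
  let ?c = "(\<chi> i. 2 * pi) :: real ^ 'd"
  have HK: "(\<integral>x. g x \<partial>cell_measure) = integral (cbox 0 ?c) g"
    if "continuous_on UNIV g" for g :: "real ^ 'd \<Rightarrow> complex"
  proof -
    have "(\<integral>x. g x \<partial>cell_measure) = integral Omega g"
      using integrable_continuous_cell[OF that] by (rule lebesgue_integral_eq_integral) simp
    then show ?thesis
      by (simp add: Omega_def integral_open_interval)
  qed
  have int: "q integrable_on cbox a b" for a b
    using cont by (intro integrable_continuous) (auto intro: continuous_on_subset)
  have cb: "x \<in> cbox a b \<longleftrightarrow> (a $ j \<le> x $ j \<and> x $ j \<le> b $ j) \<and>
      (\<forall>i. i \<noteq> j \<longrightarrow> a $ i \<le> x $ i \<and> x $ i \<le> b $ i)" for x a b :: "real ^ 'd"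
    unfolding mem_box_cart by metis
  note slab = set_eq_iff cb lo_def hi_def inner_axis
  have B: "axis j (1::real) \<in> Basis"
    by (simp add: axis_in_Basis_iff)
  have "(\<integral>x. q (x + s *\<^sub>R axis j 1) \<partial>cell_measure) = integral (cbox 0 ?c) (\<lambda>x. q (x + s *\<^sub>R axis j 1))"
    by (rule HK) (intro continuous_intros continuous_on_compose2[OF cont]; simp)
  also have "\<dots> = integral (cbox (lo s) (hi (2 * pi + s))) q"
  proof -
    have "lo s - s *\<^sub>R axis j 1 = 0" "hi (2 * pi + s) - s *\<^sub>R axis j 1 = ?c"
      by (auto simp: lo_def hi_def vec_eq_iff axis_def)
    then show ?thesis
      using integral_shift_cbox[of "lo s" "s *\<^sub>R axis j 1" "hi (2 * pi + s)" q] by simp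
  qed
  also have "\<dots> = integral (cbox (lo s) (hi (2 * pi + s)) \<inter> {x. x \<bullet> axis j 1 \<le> 2 * pi}) q +
      integral (cbox (lo s) (hi (2 * pi + s)) \<inter> {x. x \<bullet> axis j 1 \<ge> 2 * pi}) q"
    by (rule integral_split[OF int B])
  also have "cbox (lo s) (hi (2 * pi + s)) \<inter> {x. x \<bullet> axis j 1 \<le> 2 * pi} = cbox (lo s) ?c"
    using s by (auto simp: slab)
  also have "cbox (lo s) (hi (2 * pi + s)) \<inter> {x. x \<bullet> axis j 1 \<ge> 2 * pi} = cbox (lo (2 * pi)) (hi (2 * pi + s))"
    using s by (auto simp: slab)
  also have "integral (cbox (lo (2 * pi)) (hi (2 * pi + s))) q = integral (cbox 0 (hi s)) q"
  proof -
    have "lo (2 * pi) - (2 * pi) *\<^sub>R axis j 1 = 0"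
         "hi (2 * pi + s) - (2 * pi) *\<^sub>R axis j 1 = hi s"
      by (auto simp: lo_def hi_def vec_eq_iff axis_def)
    moreover have "(\<lambda>x. q (x + (2 * pi) *\<^sub>R axis j 1)) = q"
      using per by (auto simp: periodic_def)
    ultimately show ?thesis
      using integral_shift_cbox[of "lo (2 * pi)" "(2 * pi) *\<^sub>R axis j 1" "hi (2 * pi + s)" q] by simp
  qed
  also have "integral (cbox (lo s) ?c) q + integral (cbox 0 (hi s)) q = integral (cbox 0 ?c) q"
  proof -
    have "cbox 0 ?c \<inter> {x. x \<bullet> axis j 1 \<le> s} = cbox 0 (hi s)"
      using s by (auto simp: slab)
    moreover have "cbox 0 ?c \<inter> {x. x \<bullet> axis j 1 \<ge> s} = cbox (lo s) ?c"
      using s by (auto simp: slab)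
    ultimately show ?thesis
      using integral_split[OF int B, of 0 ?c s] by simp
  qed
  also have "\<dots> = (\<integral>x. q x \<partial>cell_measure)"
    by (rule HK[OF cont, symmetric])
  finally show ?thesis .
qed

text \<open>
  By translation invariance every difference quotient has mean zero; the quotients converge to the
  partial derivative, dominated by a bound for that derivative on a slightly larger cell.
\<close>

lemma integral_cell_partial:
  fixes q :: "real ^ 'd::finite \<Rightarrow> complex"
  assumes per: "periodic q" and diff: "\<And>x. q differentiable (at x)"
    and cont: "continuous_on UNIV (partial j q)"
  shows "(\<integral>x. partial j q x \<partial>cell_measure) = 0"
proof -
  interpret finite_measure "cell_measure :: (real ^ 'd) measure"
    by (rule finite_measure_cell)
  have qcont: "continuous_on UNIV q"
    using diff by (simp add: continuous_at_imp_continuous_on differentiable_imp_continuous_within)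
  define s :: "nat \<Rightarrow> real" where "s n = 1 / real (Suc n)" for n
  have s: "0 < s n" "s n \<le> 1" "s n \<le> 2 * pi" for n
  proof -
    show "0 < s n" "s n \<le> 1"
      by (auto simp: s_def)
    then show "s n \<le> 2 * pi"
      using pi_gt3 by linarith
  qed
  define D where "D n x = (q (x + s n *\<^sub>R axis j 1) - q x) /\<^sub>R s n" for n x
  \<comment> \<open>the steps are at most 1, so segments starting in the cell stay in this box\<close>
  let ?K = "cbox 0 (\<chi> i. 2 * pi + 1) :: (real ^ 'd) set"
  obtain B where B: "\<And>x. x \<in> ?K \<Longrightarrow> cmod (partial j q x) \<le> B"
  proof -
    have "compact (partial j q ` ?K)"
      using cont by (intro compact_continuous_image) (auto intro: continuous_on_subset)
    then have "bounded (partial j q ` ?K)"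
      by (rule compact_imp_bounded)
    then show ?thesis
      using that by (auto simp: bounded_iff)
  qed
  have Dcont: "continuous_on UNIV (D n)" for n
    unfolding D_def by (intro continuous_intros continuous_on_compose2[OF qcont] qcont; simp)
  have Dbound: "cmod (D n x) \<le> B" if "x \<in> Omega" for n x
  proof -
    have "norm (q (x + s n *\<^sub>R axis j 1) - q (x + 0 *\<^sub>R axis j 1)) \<le> B * norm (s n - 0)"
    proof (rule differentiable_bound[where S = "{0..s n}"])
      show "((\<lambda>s. q (x + s *\<^sub>R axis j 1)) has_derivative
          (\<lambda>h. h *\<^sub>R partial j q (x + r *\<^sub>R axis j 1))) (at r within {0..s n})" for r
        using has_vector_derivative_along_axis[OF diff] by (simp add: has_vector_derivative_def)
      show "onorm (\<lambda>h. h *\<^sub>R partial j q (x + r *\<^sub>R axis j 1)) \<le> B" if r: "r \<in> {0..s n}" for r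
      proof (rule onorm_le)
        have "x + r *\<^sub>R axis j 1 \<in> ?K"
          using \<open>x \<in> Omega\<close> r s(2)[of n]
          by (auto simp: mem_box_cart Omega_def axis_def add_mono less_imp_le intro: add_nonneg_nonneg add_increasing2)
        then show "norm (h *\<^sub>R partial j q (x + r *\<^sub>R axis j 1)) \<le> B * norm h" for h
          using B by (simp add: mult.commute[of B] mult_left_mono)
      qed
    qed (use s(1)[of n] in auto)
    then show ?thesis
      using s(1)[of n] by (simp add: D_def divide_simps mult.commute)
  qed
  have "(\<lambda>n. \<integral>x. D n x \<partial>cell_measure) \<longlonglongrightarrow> (\<integral>x. partial j q x \<partial>cell_measure)"
  proof (rule integral_dominated_convergence[where w = "\<lambda>_. B"])
    show "partial j q \<in> borel_measurable cell_measure"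
      using integrable_continuous_cell[OF cont] by auto
    show "D n \<in> borel_measurable cell_measure" for n
      using integrable_continuous_cell[OF Dcont] by auto
    show "AE x in cell_measure. (\<lambda>n. D n x) \<longlonglongrightarrow> partial j q x"
    proof (rule AE_I2)
      fix x
      have "((\<lambda>r. q (x + r *\<^sub>R axis j 1)) has_vector_derivative partial j q x) (at 0)"
        using has_vector_derivative_along_axis[OF diff, of x j 0] by simp
      then have "(\<lambda>h. norm (q (x + h *\<^sub>R axis j 1) - q x - h *\<^sub>R partial j q x) / norm h) \<midarrow>0\<rightarrow> 0"
        by (simp add: has_vector_derivative_def has_derivative_at)
      then have "(\<lambda>h. norm ((q (x + h *\<^sub>R axis j 1) - q x) /\<^sub>R h - partial j q x)) \<midarrow>0\<rightarrow> 0"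
      proof (rule Lim_transform_eventually)
        have "norm (q (x + h *\<^sub>R axis j 1) - q x - h *\<^sub>R partial j q x) / norm h =
            norm ((q (x + h *\<^sub>R axis j 1) - q x) /\<^sub>R h - partial j q x)" if "h \<noteq> 0" for h
        proof -
          have "(q (x + h *\<^sub>R axis j 1) - q x) /\<^sub>R h - partial j q x =
              (q (x + h *\<^sub>R axis j 1) - q x - h *\<^sub>R partial j q x) /\<^sub>R h"
            using that by (simp add: scaleR_diff_right)
          then show ?thesis
            by (simp add: divide_inverse_commute)
        qed
        then show "\<forall>\<^sub>F h in at 0. norm (q (x + h *\<^sub>R axis j 1) - q x - h *\<^sub>R partial j q x) / norm h =
            norm ((q (x + h *\<^sub>R axis j 1) - q x) /\<^sub>R h - partial j q x)"
          by (auto simp: eventually_at_filter)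
      qed
      then have "((\<lambda>h. (q (x + h *\<^sub>R axis j 1) - q x) /\<^sub>R h) \<longlongrightarrow> partial j q x) (at 0)"
        by (simp add: tendsto_norm_zero_iff LIM_zero_iff)
      moreover have "filterlim s (at 0) sequentially"
        unfolding s_def filterlim_at using LIMSEQ_inverse_real_of_nat by (auto simp: inverse_eq_divide)
      ultimately show "(\<lambda>n. D n x) \<longlonglongrightarrow> partial j q x"
        unfolding D_def by (rule filterlim_compose)
    qed
    show "AE x in cell_measure. norm (D n x) \<le> B" for n
      using Dbound by (intro AE_I2) auto
  qed auto
  moreover have "(\<integral>x. D n x \<partial>cell_measure) = 0" for n
  proof -
    have c: "continuous_on UNIV (\<lambda>x. q (x + s n *\<^sub>R axis j 1))"
      by (intro continuous_intros continuous_on_compose2[OF qcont]; simp)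
    show ?thesis
      unfolding D_def
      using integral_cell_translate[OF per qcont, of "s n" j] s[of n]
        integrable_continuous_cell[OF qcont] integrable_continuous_cell[OF c]
      by simp
  qed
  ultimately show ?thesis
    by (simp add: LIMSEQ_const_iff)
qed

section \<open>The trigonometric system\<close>

text \<open>
  Kept opaque, so that a product of two exponentials is visibly this constant times an exponential.
\<close>

definition phi_const :: "'d::finite itself \<Rightarrow> complex" where
  "phi_const _ = complex_of_real ((2 * pi) powr (- real CARD('d) / 2))"

lemma phi_eq: "phi (k :: int ^ 'd::finite) x = phi_const TYPE('d) * exp (\<i> * of_real (freq k \<bullet> x))"
  by (simp add: phi_def phi_const_def)

lemma freq_0 [simp]: "freq 0 = 0"
  by (simp add: freq_def vec_eq_iff)

lemma freq_uminus: "freq (- k) = - freq k"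
  by (simp add: freq_def vec_eq_iff)

lemma freq_add: "freq (k + l) = freq k + freq l"
  by (simp add: freq_def vec_eq_iff)

lemma cnj_phi: "cnj (phi k x) = phi (- k) x"
  by (simp add: phi_eq freq_uminus exp_cnj phi_const_def)

lemma phi_mult: "phi k x * phi l x = phi_const TYPE('d) * phi (k + l) x"
  for k l :: "int ^ 'd::finite"
  by (simp add: phi_eq freq_add inner_add_left exp_add ring_distribs)

lemma phi_const_nonzero: "phi_const TYPE('d::finite) \<noteq> 0"
  by (simp add: phi_const_def)

lemma has_derivative_phi:
  "((\<lambda>x. a * phi k x) has_derivative
     (\<lambda>h. a * \<i> * of_real (freq k \<bullet> h) * phi k x)) (at x within S)"
proof -
  have "((\<lambda>x. exp (\<i> * complex_of_real (freq k \<bullet> x))) has_derivative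
      (\<lambda>h. exp (\<i> * of_real (freq k \<bullet> x)) * (\<i> * of_real (freq k \<bullet> h)))) (at x within S)"
    by (rule has_derivative_compose[where g = exp, OF _ DERIV_exp[unfolded has_field_derivative_def]])
      (auto intro!: derivative_eq_intros)
  then have "((\<lambda>x. a * phi_const TYPE('a) * exp (\<i> * complex_of_real (freq k \<bullet> x))) has_derivative
      (\<lambda>h. a * phi_const TYPE('a) * (exp (\<i> * of_real (freq k \<bullet> x)) * (\<i> * of_real (freq k \<bullet> h)))))
      (at x within S)"
    by (rule has_derivative_mult_right)
  then show ?thesis
    by (simp add: phi_eq algebra_simps)
qed

lemma differentiable_phi: "phi k differentiable (at x)"
  using has_derivative_phi[of 1 k x UNIV] unfolding differentiable_def by auto

lemma partial_phi:
  "partial j (\<lambda>x. a * phi k x) = (\<lambda>x. (a * \<i> * of_int (k $ j)) * phi k x)"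
proof
  fix x
  have "frechet_derivative (\<lambda>x. a * phi k x) (at x) = (\<lambda>h. a * \<i> * of_real (freq k \<bullet> h) * phi k x)"
    using has_derivative_phi by (rule frechet_derivative_at[symmetric])
  then show "partial j (\<lambda>x. a * phi k x) x = (a * \<i> * of_int (k $ j)) * phi k x"
    by (simp add: partial_def inner_axis freq_def)
qed

lemma continuous_on_phi [continuous_intros]: "continuous_on S (phi k)"
  unfolding phi_eq by (intro continuous_intros)

lemma C_k_phi: "C_k m (\<lambda>x. a * phi k x)"
  by (induction m arbitrary: a) (auto simp: partial_phi intro!: continuous_intros derivative_intros differentiable_phi)

lemma periodic_phi: "periodic (phi k)"
proof -
  have "exp (\<i> * complex_of_real (freq k \<bullet> (x + (2 * pi) *\<^sub>R axis j 1))) =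
        exp (\<i> * complex_of_real (freq k \<bullet> x))" for j and x :: "real ^ 'a"
  proof -
    have "\<i> * complex_of_real (freq k \<bullet> (x + (2 * pi) *\<^sub>R axis j 1)) =
        \<i> * complex_of_real (freq k \<bullet> x) + \<i> * (of_int (k $ j) * (of_real pi * 2))"
      by (simp add: inner_add_right inner_axis freq_def algebra_simps)
    then show ?thesis
      by (simp add: exp_plus_2pin)
  qed
  then show ?thesis
    by (simp add: periodic_def phi_eq)
qed

lemma periodic_mult: "periodic v \<Longrightarrow> periodic w \<Longrightarrow> periodic (\<lambda>x. v x * w x)"
  by (simp add: periodic_def)

lemma periodic_const: "periodic (\<lambda>x. c)"
  by (simp add: periodic_def)

lemma test_function_phi: "test_function (\<lambda>x. a * phi k x)"
  unfolding test_function_def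
  by (auto intro: C_k_phi periodic_mult[OF periodic_const periodic_phi])

lemma phi_in_L2: "phi k \<in> L2"
  by (intro L2_continuous continuous_intros)

lemma measure_Omega: "measure lebesgue (Omega :: (real ^ 'd::finite) set) = (2 * pi) ^ CARD('d)"
proof -
  have "measure lebesgue (box 0 (\<chi> j. 2 * pi) :: (real ^ 'd) set) =
      measure lebesgue (cbox 0 (\<chi> j. 2 * pi) :: (real ^ 'd) set)"
    by (simp add: measure_lborel_box_eq measure_lborel_cbox_eq)
  moreover have "cbox 0 (\<chi> j. 2 * pi) \<noteq> ({} :: (real ^ 'd) set)"
    by (simp add: interval_ne_empty_cart)
  ultimately show ?thesis
    by (simp add: content_cbox_cart Omega_def)
qed

text \<open>
  A non-constant exponential is, up to a factor, one of its own partial derivatives, and these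
  have mean zero.
\<close>

lemma phi_orthonormal:
  fixes k l :: "int ^ 'd::finite"
  shows "(\<integral>x. phi k x * cnj (phi l x) \<partial>cell_measure) = (if k = l then 1 else 0)"
proof (cases "k = l")
  case True
  have "phi k x * cnj (phi k x) = of_real (1 / (2 * pi) ^ CARD('d))" for x
  proof -
    have "(cmod (phi k x))\<^sup>2 = ((2 * pi) powr (- real CARD('d) / 2)) ^ 2"
      by (simp add: phi_def norm_mult)
    also have "\<dots> = (2 * pi) powr (- real CARD('d))"
      by (simp add: power2_eq_square flip: powr_add)
    also have "\<dots> = 1 / (2 * pi) ^ CARD('d)"
      by (simp add: powr_minus powr_realpow divide_inverse)
    finally show ?thesis
      by (simp add: complex_norm_square[symmetric])
  qed
  then show ?thesis
    using True by (simp add: measure_restrict_space measure_Omega scaleR_conv_of_real)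
next
  case False
  then obtain j where j: "(k - l) $ j \<noteq> 0"
    by (auto simp: vec_eq_iff)
  have "(\<integral>x. partial j (\<lambda>x. 1 * phi (k - l) x) x \<partial>cell_measure) = 0"
  proof (rule integral_cell_partial)
    show "continuous_on UNIV (partial j (\<lambda>x. 1 * phi (k - l) x))"
      unfolding partial_phi by (intro continuous_intros)
  qed (auto simp: differentiable_phi periodic_phi)
  then have "(\<integral>x. phi (k - l) x \<partial>cell_measure) = 0"
    using j unfolding partial_phi by simp
  then show ?thesis
    using False by (simp add: cnj_phi phi_mult)
qed


section \<open>Bessel's identity and best approximation\<close>

lemma fourier_eq: "fourier v k = (\<integral>x. v x * cnj (phi k x) \<partial>cell_measure)"
  by (simp add: fourier_def set_integral_cell)

lemma fourier_add:
  "u \<in> L2 \<Longrightarrow> v \<in> L2 \<Longrightarrow> fourier (\<lambda>x. u x + v x) k = fourier u k + fourier v k"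
  by (simp add: fourier_eq ring_distribs L2_integrable_mult_cnj phi_in_L2)

lemma fourier_diff:
  "u \<in> L2 \<Longrightarrow> v \<in> L2 \<Longrightarrow> fourier (\<lambda>x. u x - v x) k = fourier u k - fourier v k"
  by (simp add: fourier_eq ring_distribs L2_integrable_mult_cnj phi_in_L2)

lemma fourier_cmult: "fourier (\<lambda>x. c * v x) k = c * fourier v k"
  by (simp add: fourier_eq mult.assoc)

definition trig_poly :: "(int ^ 'd::finite \<Rightarrow> complex) \<Rightarrow> (int ^ 'd) set \<Rightarrow> real ^ 'd \<Rightarrow> complex" where
  "trig_poly c F x = (\<Sum>k\<in>F. c k * phi k x)"

lemma continuous_on_trig_poly [continuous_intros]: "continuous_on S (trig_poly c F)"
  unfolding trig_poly_def by (intro continuous_intros)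

lemma trig_poly_in_L2: "trig_poly c F \<in> L2"
  by (intro L2_continuous continuous_intros)

lemma fourier_trig_poly:
  assumes "finite F"
  shows "fourier (trig_poly c F) k = (if k \<in> F then c k else 0)"
proof -
  have "fourier (trig_poly c F) k = (\<Sum>l\<in>F. \<integral>x. c l * (phi l x * cnj (phi k x)) \<partial>cell_measure)"
    unfolding fourier_eq trig_poly_def sum_distrib_right mult.assoc
    by (intro Bochner_Integration.integral_sum) (simp add: L2_integrable_mult_cnj phi_in_L2)
  also have "\<dots> = (\<Sum>l\<in>F. if l = k then c l else 0)"
    by (intro sum.cong) (auto simp: phi_orthonormal)
  finally show ?thesis
    using assms by simp
qed

lemma integral_mult_cnj_trig_poly:
  assumes "v \<in> L2"
  shows "(\<integral>x. v x * cnj (trig_poly c F x) \<partial>cell_measure) = (\<Sum>k\<in>F. cnj (c k) * fourier v k)"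
proof -
  have "(\<integral>x. v x * cnj (trig_poly c F x) \<partial>cell_measure) =
      (\<integral>x. (\<Sum>k\<in>F. cnj (c k) * (v x * cnj (phi k x))) \<partial>cell_measure)"
    by (simp add: trig_poly_def sum_distrib_left mult_ac)
  also have "\<dots> = (\<Sum>k\<in>F. cnj (c k) * fourier v k)"
    using assms by (subst Bochner_Integration.integral_sum) (auto simp: L2_integrable_mult_cnj phi_in_L2 fourier_eq)
  finally show ?thesis .
qed

definition l2sq :: "(real ^ 'd::finite \<Rightarrow> complex) \<Rightarrow> real" where
  "l2sq v = (\<integral>x. (cmod (v x))\<^sup>2 \<partial>cell_measure)"

lemma l2sq_nonneg [simp]: "0 \<le> l2sq v"
  by (simp add: l2sq_def)

lemma l2sq_complex: "of_real (l2sq v) = (\<integral>x. v x * cnj (v x) \<partial>cell_measure)"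
  unfolding l2sq_def integral_complex_of_real[symmetric] complex_norm_square ..

lemma l2sq_diff:
  assumes "u \<in> L2" "v \<in> L2"
  shows "l2sq (\<lambda>x. u x - v x) = l2sq u - 2 * Re (\<integral>x. u x * cnj (v x) \<partial>cell_measure) + l2sq v"
proof -
  have *: "(cmod (u x - v x))\<^sup>2 = (cmod (u x))\<^sup>2 - 2 * Re (u x * cnj (v x)) + (cmod (v x))\<^sup>2" for x
    unfolding cmod_power2 by (simp add: power2_eq_square algebra_simps)
  have "l2sq (\<lambda>x. u x - v x) =
      (\<integral>x. (cmod (u x))\<^sup>2 - 2 * Re (u x * cnj (v x)) + (cmod (v x))\<^sup>2 \<partial>cell_measure)"
    by (simp only: l2sq_def *)
  also have "\<dots> = l2sq u - 2 * (\<integral>x. Re (u x * cnj (v x)) \<partial>cell_measure) + l2sq v"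
  proof -
    have "integrable cell_measure (\<lambda>x. Re (u x * cnj (v x)))"
      using L2_integrable_mult_cnj[OF assms] by (rule integrable_Re)
    then show ?thesis
      using assms by (simp add: l2sq_def L2_integrable_norm_sq del: times_complex.sel)
  qed
  finally show ?thesis
    using integral_Re[OF L2_integrable_mult_cnj[OF assms]] by simp
qed

text \<open>Completing the square in the coefficients.\<close>

lemma l2sq_diff_trig_poly:
  assumes v: "v \<in> L2" and F: "finite F"
  shows "l2sq (\<lambda>x. v x - trig_poly c F x) =
    l2sq v - (\<Sum>k\<in>F. (cmod (fourier v k))\<^sup>2) + (\<Sum>k\<in>F. (cmod (fourier v k - c k))\<^sup>2)"
proof -
  have *: "(cmod (fourier v k - c k))\<^sup>2 =
      (cmod (fourier v k))\<^sup>2 - 2 * Re (cnj (c k) * fourier v k) + (cmod (c k))\<^sup>2" for k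
    unfolding cmod_power2 by (simp add: power2_eq_square algebra_simps)
  have "complex_of_real (l2sq (trig_poly c F)) = (\<Sum>k\<in>F. cnj (c k) * c k)"
    by (simp add: l2sq_complex integral_mult_cnj_trig_poly trig_poly_in_L2 fourier_trig_poly F)
  also have "\<dots> = of_real (\<Sum>k\<in>F. (cmod (c k))\<^sup>2)"
    unfolding of_real_sum by (simp add: complex_norm_square mult.commute del: of_real_power)
  finally have "l2sq (trig_poly c F) = (\<Sum>k\<in>F. (cmod (c k))\<^sup>2)"
    by (simp only: of_real_eq_iff)
  then show ?thesis
    using v by (simp add: l2sq_diff trig_poly_in_L2 integral_mult_cnj_trig_poly *
        sum.distrib sum_subtractf sum_distrib_left)
qed

section \<open>Trigonometric polynomials\<close>

lemma trig_span_iff: "v \<in> trig_span \<Lambda> \<longleftrightarrow> (\<exists>c F. finite F \<and> F \<subseteq> \<Lambda> \<and> v = trig_poly c F)"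
  unfolding trig_span_def trig_poly_def by blast

lemma trig_poly_in_trig_span: "finite F \<Longrightarrow> F \<subseteq> \<Lambda> \<Longrightarrow> trig_poly c F \<in> trig_span \<Lambda>"
  unfolding trig_span_iff by blast

lemma trig_poly_extend:
  assumes "finite G" "F \<subseteq> G"
  shows "trig_poly c F = trig_poly (\<lambda>k. if k \<in> F then c k else 0) G"
proof
  fix x
  have "(\<Sum>k\<in>F. c k * phi k x) = (\<Sum>k\<in>F. (if k \<in> F then c k else 0) * phi k x)"
    by (rule sum.cong) auto
  also have "\<dots> = (\<Sum>k\<in>G. (if k \<in> F then c k else 0) * phi k x)"
    using assms by (intro sum.mono_neutral_left) auto
  finally show "trig_poly c F x = trig_poly (\<lambda>k. if k \<in> F then c k else 0) G x"
    by (simp only: trig_poly_def)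
qed

lemma trig_span_zero: "(\<lambda>x. 0) \<in> trig_span \<Lambda>"
  using trig_poly_in_trig_span[of "{}" \<Lambda> "\<lambda>_. 0"] by (simp add: trig_poly_def[abs_def])

lemma trig_span_add:
  assumes "u \<in> trig_span \<Lambda>" "v \<in> trig_span \<Lambda>"
  shows "(\<lambda>x. u x + v x) \<in> trig_span \<Lambda>"
proof -
  obtain c F d G where *: "finite F" "F \<subseteq> \<Lambda>" "u = trig_poly c F" "finite G" "G \<subseteq> \<Lambda>" "v = trig_poly d G"
    using assms unfolding trig_span_iff by blast
  define c' where "c' k = (if k \<in> F then c k else 0)" for k
  define d' where "d' k = (if k \<in> G then d k else 0)" for k
  have "u = trig_poly c' (F \<union> G)" "v = trig_poly d' (F \<union> G)"
    unfolding * c'_def d'_def by (rule trig_poly_extend; use * in auto)+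
  then have "(\<lambda>x. u x + v x) = trig_poly (\<lambda>k. c' k + d' k) (F \<union> G)"
    by (simp add: fun_eq_iff trig_poly_def sum.distrib ring_distribs)
  then show ?thesis
    using * trig_poly_in_trig_span[of "F \<union> G" \<Lambda>] by simp
qed

lemma trig_span_cmult:
  assumes "u \<in> trig_span \<Lambda>"
  shows "(\<lambda>x. a * u x) \<in> trig_span \<Lambda>"
proof -
  obtain c F where *: "finite F" "F \<subseteq> \<Lambda>" "u = trig_poly c F"
    using assms unfolding trig_span_iff by blast
  have "(\<lambda>x. a * u x) = trig_poly (\<lambda>k. a * c k) F"
    by (simp add: * fun_eq_iff trig_poly_def sum_distrib_left mult.assoc)
  then show ?thesis
    using * trig_poly_in_trig_span by metis
qed

lemma trig_span_diff:
  assumes "u \<in> trig_span \<Lambda>" "v \<in> trig_span \<Lambda>"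
  shows "(\<lambda>x. u x - v x) \<in> trig_span \<Lambda>"
  using trig_span_add[OF assms(1) trig_span_cmult[OF assms(2), of "-1"]] by simp

lemma trig_span_sum:
  assumes "\<And>i. i \<in> I \<Longrightarrow> v i \<in> trig_span \<Lambda>"
  shows "(\<lambda>x. \<Sum>i\<in>I. v i x) \<in> trig_span \<Lambda>"
  using assms
  by (induction I rule: infinite_finite_induct) (auto intro: trig_span_add trig_span_zero)

lemma trig_span_phi: "k \<in> \<Lambda> \<Longrightarrow> phi k \<in> trig_span \<Lambda>"
  using trig_poly_in_trig_span[of "{k}" \<Lambda> "\<lambda>_. 1"] by (simp add: trig_poly_def[abs_def])

lemma trig_span_const: "(\<lambda>x. a) \<in> trig_span (UNIV :: (int ^ 'd::finite) set)"
proof -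
  have "(\<lambda>x. a / phi_const TYPE('d) * phi (0 :: int ^ 'd) x) = (\<lambda>x. a)"
    by (simp add: phi_eq phi_const_nonzero)
  then show ?thesis
    using trig_span_cmult[OF trig_span_phi[of "0 :: int ^ 'd" UNIV], of "a / phi_const TYPE('d)"] by simp
qed

lemma trig_span_mult:
  assumes "u \<in> trig_span UNIV" "v \<in> trig_span (UNIV :: (int ^ 'd::finite) set)"
  shows "(\<lambda>x. u x * v x) \<in> trig_span UNIV"
proof -
  obtain c F d G where *: "finite F" "u = trig_poly c F" "finite G" "v = trig_poly d G"
    using assms unfolding trig_span_iff by blast
  have "(\<lambda>x. u x * v x) = (\<lambda>x. \<Sum>k\<in>F. \<Sum>l\<in>G. (c k * d l * phi_const TYPE('d)) * phi (k + l) x)"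
  proof
    fix x
    have "u x * v x = (\<Sum>k\<in>F. \<Sum>l\<in>G. (c k * d l) * (phi k x * phi l x))"
      by (simp add: * trig_poly_def sum_product mult_ac)
    then show "u x * v x = (\<Sum>k\<in>F. \<Sum>l\<in>G. (c k * d l * phi_const TYPE('d)) * phi (k + l) x)"
      by (simp add: phi_mult mult.assoc)
  qed
  then show ?thesis
    by (simp only:) (intro trig_span_sum trig_span_cmult trig_span_phi UNIV_I)
qed

lemma trig_span_in_L2: "v \<in> trig_span \<Lambda> \<Longrightarrow> v \<in> L2"
  by (auto simp: trig_span_iff trig_poly_in_L2)


section \<open>Completeness of the trigonometric system\<close>

text \<open>
  The torus is realised as a compact subset of \<open>\<complex>\<^sup>d\<close>, on which polynomials in the real and imaginary
  parts of the coordinates are uniformly dense in the continuous functions.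
\<close>

definition torus :: "(complex ^ 'd::finite) set" where
  "torus = {z. \<forall>j. cmod (z $ j) = 1}"

definition wrap :: "real ^ 'd::finite \<Rightarrow> complex ^ 'd" where
  "wrap x = (\<chi> j. exp (\<i> * of_real (x $ j)))"

lemma wrap_in_torus: "wrap x \<in> torus"
  by (simp add: wrap_def torus_def)

lemma compact_torus: "compact (torus :: (complex ^ 'd::finite) set)"
proof -
  have "closed (torus :: (complex ^ 'd) set)"
    unfolding torus_def Collect_all_eq
    by (intro closed_INT ballI closed_Collect_eq continuous_intros)
  moreover have "bounded (torus :: (complex ^ 'd) set)"
  proof (rule boundedI)
    fix z :: "complex ^ 'd" assume "z \<in> torus"
    then show "norm z \<le> (\<Sum>j\<in>(UNIV :: 'd set). 1)"
      using L2_set_le_sum[of UNIV "\<lambda>j. cmod (z $ j)"] by (simp add: torus_def norm_vec_def)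
  qed
  ultimately show ?thesis
    by (simp add: compact_eq_bounded_closed)
qed

lemma exp_coordinate_in_trig_span:
  "(\<lambda>x. exp (\<i> * of_real (x $ j))) \<in> trig_span (UNIV :: (int ^ 'd::finite) set)"
  "(\<lambda>x. exp (- (\<i> * of_real (x $ j)))) \<in> trig_span (UNIV :: (int ^ 'd::finite) set)"
proof -
  have ax: "freq (axis j 1) \<bullet> x = x $ j" for x :: "real ^ 'd"
  proof -
    have "freq (axis j 1 :: int ^ 'd) = axis j 1"
      by (simp add: freq_def axis_def vec_eq_iff)
    then show ?thesis
      by (simp add: inner_axis')
  qed
  have "(\<lambda>x. exp (\<i> * of_real (x $ j))) = (\<lambda>x. (1 / phi_const TYPE('d)) * phi (axis j 1 :: int ^ 'd) x)"
    by (simp add: phi_eq phi_const_nonzero ax)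
  then show "(\<lambda>x. exp (\<i> * of_real (x $ j))) \<in> trig_span (UNIV :: (int ^ 'd::finite) set)"
    using trig_span_cmult trig_span_phi by (metis UNIV_I)
  have "(\<lambda>x. exp (- (\<i> * of_real (x $ j)))) = (\<lambda>x. (1 / phi_const TYPE('d)) * phi (- axis j 1 :: int ^ 'd) x)"
    by (simp add: phi_eq phi_const_nonzero ax freq_uminus)
  then show "(\<lambda>x. exp (- (\<i> * of_real (x $ j)))) \<in> trig_span (UNIV :: (int ^ 'd::finite) set)"
    using trig_span_cmult trig_span_phi by (metis UNIV_I)
qed

text \<open>On the torus the real coordinates of a point are cosines and sines.\<close>

lemma polynomial_wrap_in_trig_span:
  fixes g :: "complex ^ 'd::finite \<Rightarrow> real"
  assumes "real_polynomial_function g"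
  shows "(\<lambda>x. of_real (g (wrap x))) \<in> trig_span UNIV"
  using assms
proof (induction g rule: real_polynomial_function.induct)
  case (linear g)
  interpret bounded_linear g by fact
  have b: "(\<lambda>x. of_real (wrap x \<bullet> b)) \<in> trig_span UNIV" if "b \<in> Basis" for b :: "complex ^ 'd"
  proof -
    obtain j u where b: "b = axis j u" "u = 1 \<or> u = \<i>"
      using \<open>b \<in> Basis\<close> by (auto simp: Basis_vec_def Basis_complex_def)
    have cs: "complex_of_real (Re (exp z)) = 1 / 2 * exp z + 1 / 2 * exp (- z)"
         "complex_of_real (Im (exp z)) = - \<i> / 2 * exp z + \<i> / 2 * exp (- z)"
      if "z = \<i> * of_real y" for z y
      using that by (auto simp: complex_eq_iff Re_exp Im_exp)
    have "(\<lambda>x. complex_of_real (wrap x \<bullet> b)) =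
        (\<lambda>x. (if u = 1 then 1 / 2 else - \<i> / 2) * exp (\<i> * of_real (x $ j)) +
             (if u = 1 then 1 / 2 else \<i> / 2) * exp (- (\<i> * of_real (x $ j))))"
      using b(2) by (auto simp: b(1) wrap_def inner_axis cs[OF refl] fun_eq_iff)
    then show ?thesis
      by (simp only:) (intro trig_span_add trig_span_cmult exp_coordinate_in_trig_span)
  qed
  have expand: "g z = (\<Sum>b\<in>Basis. (z \<bullet> b) *\<^sub>R g b)" for z
  proof -
    have "g (\<Sum>b\<in>Basis. (z \<bullet> b) *\<^sub>R b) = (\<Sum>b\<in>Basis. (z \<bullet> b) *\<^sub>R g b)"
      by (simp only: sum scaleR)
    then show ?thesis
      by (simp only: euclidean_representation)
  qed
  have "(\<lambda>x. complex_of_real (g (wrap x))) = (\<lambda>x. \<Sum>b\<in>Basis. of_real (g b) * of_real (wrap x \<bullet> b))"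
    by (subst expand) (simp add: mult.commute)
  then show ?case
    using b by (simp only:) (intro trig_span_sum trig_span_cmult)
next
  case (const c)
  then show ?case by (rule trig_span_const)
next
  case (add f g)
  then show ?case by (simp add: trig_span_add)
next
  case (mult f g)
  then show ?case by (simp add: trig_span_mult)
qed

text \<open>
  Membership in the closure of the trigonometric polynomials. The lemmas below enlarge the class of
  functions known to lie in it, until it contains all of \<open>L2\<close>.
\<close>

definition trig_approximable :: "(real ^ 'd::finite \<Rightarrow> complex) \<Rightarrow> bool" where
  "trig_approximable v \<longleftrightarrow> (\<forall>e>0. \<exists>p\<in>trig_span UNIV. l2sq (\<lambda>x. v x - p x) < e)"

lemma trig_approximable_limit:
  assumes v: "v \<in> L2" and u: "\<And>n. u n \<in> L2" and approx: "\<And>n. trig_approximable (u n)"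
    and lim: "(\<lambda>n. l2sq (\<lambda>x. v x - u n x)) \<longlonglongrightarrow> 0"
  shows "trig_approximable v"
  unfolding trig_approximable_def
proof (intro allI impI)
  fix e :: real assume "0 < e"
  then obtain n where n: "l2sq (\<lambda>x. v x - u n x) < e / 4"
    using order_tendstoD(2)[OF lim, of "e / 4"] by (auto simp: eventually_sequentially)
  obtain p where p: "p \<in> trig_span UNIV" "l2sq (\<lambda>x. u n x - p x) < e / 4"
    using approx[of n] \<open>0 < e\<close> unfolding trig_approximable_def by (metis divide_pos_pos zero_less_numeral)
  have int: "integrable cell_measure (\<lambda>x. (cmod (v x - u n x))\<^sup>2)"
            "integrable cell_measure (\<lambda>x. (cmod (u n x - p x))\<^sup>2)"
            "integrable cell_measure (\<lambda>x. (cmod (v x - p x))\<^sup>2)"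
    using v u[of n] trig_span_in_L2[OF p(1)] by (auto intro!: L2_integrable_norm_sq L2_diff)
  have "l2sq (\<lambda>x. v x - p x) \<le>
      (\<integral>x. 2 * (cmod (v x - u n x))\<^sup>2 + 2 * (cmod (u n x - p x))\<^sup>2 \<partial>cell_measure)"
    unfolding l2sq_def
  proof (rule integral_mono)
    show "(cmod (v x - p x))\<^sup>2 \<le> 2 * (cmod (v x - u n x))\<^sup>2 + 2 * (cmod (u n x - p x))\<^sup>2" for x
      using norm_add_sq_le[of "v x - u n x" "u n x - p x"] by simp
  qed (use int in auto)
  also have "\<dots> = 2 * l2sq (\<lambda>x. v x - u n x) + 2 * l2sq (\<lambda>x. u n x - p x)"
    using int by (simp add: l2sq_def)
  also have "\<dots> < e"
    using n p by simp
  finally show "\<exists>p\<in>trig_span UNIV. l2sq (\<lambda>x. v x - p x) < e"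
    using p(1) by blast
qed

lemma trig_approximable_pointwise_limit:
  assumes v: "v \<in> L2" and u: "\<And>n. u n \<in> L2" and approx: "\<And>n. trig_approximable (u n)"
    and lim: "AE x in cell_measure. (\<lambda>n. u n x) \<longlonglongrightarrow> v x"
    and w: "w \<in> L2" and bound: "\<And>n x. x \<in> Omega \<Longrightarrow> cmod (v x - u n x) \<le> cmod (w x)"
  shows "trig_approximable v"
proof (rule trig_approximable_limit[OF v u approx])
  have "(\<lambda>n. l2sq (\<lambda>x. v x - u n x)) \<longlonglongrightarrow> (\<integral>x. (0::real) \<partial>(cell_measure :: (real ^ 'a) measure))"
    unfolding l2sq_def
  proof (rule integral_dominated_convergence[where w = "\<lambda>x. (cmod (w x))\<^sup>2"])
    show "(\<lambda>x. (cmod (v x - u n x))\<^sup>2) \<in> borel_measurable cell_measure" for n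
      using L2_integrable_norm_sq[OF L2_diff[OF v u]] by auto
    show "integrable cell_measure (\<lambda>x. (cmod (w x))\<^sup>2)"
      using w by (rule L2_integrable_norm_sq)
    show "AE x in cell_measure. (\<lambda>n. (cmod (v x - u n x))\<^sup>2) \<longlonglongrightarrow> 0"
      using lim
    proof eventually_elim
      fix x assume "(\<lambda>n. u n x) \<longlonglongrightarrow> v x"
      then have "(\<lambda>n. (cmod (v x - u n x))\<^sup>2) \<longlonglongrightarrow> (cmod (v x - v x))\<^sup>2"
        by (intro tendsto_intros)
      then show "(\<lambda>n. (cmod (v x - u n x))\<^sup>2) \<longlonglongrightarrow> 0"
        by simp
    qed
    show "AE x in cell_measure. norm ((cmod (v x - u n x))\<^sup>2) \<le> (cmod (w x))\<^sup>2" for n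
      using bound by (intro AE_I2) (simp add: power_mono)
  qed auto
  then show "(\<lambda>n. l2sq (\<lambda>x. v x - u n x)) \<longlonglongrightarrow> 0"
    by simp
qed

lemma l2sq_le_bound:
  fixes v :: "real ^ 'd::finite \<Rightarrow> complex"
  assumes "v \<in> L2" "\<And>x. x \<in> Omega \<Longrightarrow> cmod (v x) \<le> b"
  shows "l2sq v \<le> b\<^sup>2 * (2 * pi) ^ CARD('d)"
proof -
  interpret finite_measure "cell_measure :: (real ^ 'd) measure"
    by (rule finite_measure_cell)
  have "l2sq v \<le> (\<integral>x. b\<^sup>2 \<partial>(cell_measure :: (real ^ 'd) measure))"
    unfolding l2sq_def
    using assms by (intro integral_mono) (auto intro: L2_integrable_norm_sq power_mono)
  then show ?thesis
    by (simp add: measure_restrict_space measure_Omega mult.commute)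
qed

lemma continuous_on_wrap: "continuous_on S wrap"
  unfolding wrap_def[abs_def] by (intro continuous_intros)

text \<open>
  Uniform approximation on the torus suffices because the cell has finite measure.
\<close>

lemma trig_approximable_wrap:
  fixes h :: "complex ^ 'd::finite \<Rightarrow> complex"
  assumes h: "continuous_on torus h"
  shows "(\<lambda>x. h (wrap x)) \<in> L2" "trig_approximable (\<lambda>x. h (wrap x))"
proof -
  show L2: "(\<lambda>x. h (wrap x)) \<in> L2"
    by (intro L2_continuous continuous_on_compose2[OF h continuous_on_wrap]) (auto simp: wrap_in_torus)
  show "trig_approximable (\<lambda>x. h (wrap x))"
    unfolding trig_approximable_def
  proof (intro allI impI)
    fix e :: real assume "0 < e"
    define V where "V = (2 * pi) ^ CARD('d)"
    \<comment> \<open>real and imaginary part are approximated up to \<open>d\<close> each; together they cost \<open>(2 * d)\<^sup>2 * V = e / 2\<close>\<close>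
    define d where "d = sqrt (e / (2 * V)) / 2"
    have "V > 0" by (simp add: V_def)
    then have d: "d > 0" "(2 * d)\<^sup>2 * V = e / 2"
      using \<open>0 < e\<close> by (auto simp: d_def)
    have "continuous_on torus (\<lambda>z. Re (h z))" "continuous_on torus (\<lambda>z. Im (h z))"
      by (intro continuous_intros h)+
    then obtain f g where f: "real_polynomial_function f" "\<And>z. z \<in> torus \<Longrightarrow> \<bar>Re (h z) - f z\<bar> < d"
      and g: "real_polynomial_function g" "\<And>z. z \<in> torus \<Longrightarrow> \<bar>Im (h z) - g z\<bar> < d"
      using Stone_Weierstrass_real_polynomial_function[OF compact_torus _ d(1)] by metis
    define p where "p x = of_real (f (wrap x)) + \<i> * of_real (g (wrap x))" for x
    have p: "p \<in> trig_span UNIV"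
      unfolding p_def[abs_def]
      by (intro trig_span_add trig_span_cmult polynomial_wrap_in_trig_span f g)
    have "cmod (h (wrap x) - p x) \<le> 2 * d" for x
      using cmod_le[of "h (wrap x) - p x"] f(2)[OF wrap_in_torus[of x]] g(2)[OF wrap_in_torus[of x]]
      by (simp add: p_def)
    then have "l2sq (\<lambda>x. h (wrap x) - p x) \<le> (2 * d)\<^sup>2 * V"
      unfolding V_def by (intro l2sq_le_bound L2_diff L2 trig_span_in_L2[OF p])
    then have "l2sq (\<lambda>x. h (wrap x) - p x) < e"
      using d(2) \<open>0 < e\<close> by linarith
    then show "\<exists>p\<in>trig_span UNIV. l2sq (\<lambda>x. h (wrap x) - p x) < e"
      using p by blast
  qed
qed

lemma Arg2pi_wrap:
  assumes "x \<in> Omega"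
  shows "Arg2pi (wrap x $ j) = x $ j" "wrap x $ j \<noteq> 1"
proof -
  have x: "0 < x $ j" "x $ j < 2 * pi"
    using assms by (auto simp: Omega_def mem_box_cart)
  then show *: "Arg2pi (wrap x $ j) = x $ j"
    by (intro Arg2pi_unique[where r = 1]) (auto simp: wrap_def)
  have "Arg2pi 1 = 0"
    by (simp add: Arg2pi_eq_0)
  then show "wrap x $ j \<noteq> 1"
    using * x(1) by auto
qed

text \<open>
  A function on the cell need not match on opposite faces. Transported to the torus by the argument
  map it may therefore jump where some coordinate is \<open>1\<close>. The factor \<open>min 1 (n * \<dots>)\<close> vanishes
  there, and at every other point it is eventually \<open>1\<close>, so these continuous modifications converge
  pointwise on the open cell.
\<close>

lemma trig_approximable_continuous:
  fixes g :: "real ^ 'd::finite \<Rightarrow> complex"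
  assumes g: "continuous_on UNIV g" and M: "\<And>x. cmod (g x) \<le> M"
  shows "trig_approximable g"
proof -
  define cut :: "nat \<Rightarrow> complex ^ 'd \<Rightarrow> real"
    where "cut n z = min 1 (real n * (\<Prod>j\<in>UNIV. cmod (z $ j - 1)))" for n z
  define h where "h n z = of_real (cut n z) * g (\<chi> j. Arg2pi (z $ j))" for n z
  have cut: "0 \<le> cut n z" "cut n z \<le> 1" for n z
    by (auto simp: cut_def intro!: mult_nonneg_nonneg prod_nonneg)
  have M0: "0 \<le> M"
    using M[of 0] norm_ge_zero order_trans by blast
  have h_le: "cmod (h n z) \<le> cut n z * M" for n z
    unfolding h_def norm_mult using cut(1)[of n z] by (simp add: M mult_left_mono)
  have cut_cont: "continuous_on UNIV (cut n)" for n
    unfolding cut_def[abs_def] by (intro continuous_intros)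
  have cont: "continuous_on torus (h n)" for n
    unfolding continuous_on_eq_continuous_within
  proof
    fix z :: "complex ^ 'd" assume z: "z \<in> torus"
    have cutz: "isCont (cut n) z"
      using cut_cont by (simp add: continuous_on_eq_continuous_at)
    show "continuous (at z within torus) (h n)"
    proof (cases "\<exists>j. z $ j = 1")
      case True
      then have "(\<Prod>j\<in>UNIV. cmod (z $ j - 1)) = 0"
        by (intro prod_zero) auto
      then have "cut n z = 0"
        by (simp add: cut_def del: prod_zero_iff)
      moreover have "(cut n \<longlongrightarrow> cut n z) (at z within torus)"
        using continuous_at_imp_continuous_at_within[OF cutz] by (simp add: continuous_within)
      ultimately have "((\<lambda>y. cut n y * M) \<longlongrightarrow> 0) (at z within torus)"
        by (auto intro: tendsto_mult_left_zero)
      then have "((h n) \<longlongrightarrow> 0) (at z within torus)"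
        by (rule Lim_null_comparison[rotated]) (simp add: h_le)
      then show ?thesis
        using \<open>cut n z = 0\<close> by (simp add: continuous_within h_def)
    next
      case False
      have "z $ j \<notin> \<real>\<^sub>\<ge>\<^sub>0" for j
      proof
        assume "z $ j \<in> \<real>\<^sub>\<ge>\<^sub>0"
        then obtain r where r: "z $ j = of_real r" "r \<ge> 0"
          by (auto simp: nonneg_Reals_def)
        moreover have "cmod (z $ j) = 1"
          using z by (simp add: torus_def)
        ultimately show False
          using False by auto
      qed
      then have "isCont (\<lambda>y. Arg2pi (y $ j)) z" for j
        by (intro isCont_o2[of z "\<lambda>y. y $ j" Arg2pi] continuous_at_Arg2pi)
           (auto intro: continuous_intros)
      then have "isCont (\<lambda>y. \<chi> j. Arg2pi (y $ j)) z"
        unfolding continuous_at by (rule tendsto_vec_lambda)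
      then have "isCont (\<lambda>y. g (\<chi> j. Arg2pi (y $ j))) z"
        by (rule isCont_o2) (use g in \<open>simp add: continuous_on_eq_continuous_at\<close>)
      then have "isCont (h n) z"
        unfolding h_def[abs_def] using cutz by (intro continuous_intros)
      then show ?thesis
        using continuous_at_imp_continuous_at_within by blast
    qed
  qed
  show ?thesis
  proof (rule trig_approximable_pointwise_limit)
    show "g \<in> L2"
      using g by (rule L2_continuous)
    show "(\<lambda>x. h n (wrap x)) \<in> L2" "trig_approximable (\<lambda>x. h n (wrap x))" for n
      using cont by (rule trig_approximable_wrap)+
    show "(\<lambda>x. complex_of_real (2 * M)) \<in> L2"
      by (intro L2_continuous continuous_intros)
    show "cmod (g x - h n (wrap x)) \<le> cmod (complex_of_real (2 * M))" for n x
    proof -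
      have "cmod (h n (wrap x)) \<le> M"
        using h_le[of n "wrap x"] cut(2)[of n "wrap x"] M0 mult_right_mono[of "cut n (wrap x)" 1 M] by linarith
      then show ?thesis
        using norm_triangle_ineq4[of "g x" "h n (wrap x)"] M[of x] M0 by simp
    qed
    show "AE x in cell_measure. (\<lambda>n. h n (wrap x)) \<longlonglongrightarrow> g x"
    proof (rule AE_I2, rule tendsto_eventually)
      fix x :: "real ^ 'd" assume "x \<in> space cell_measure"
      then have x: "x \<in> Omega" by simp
      define P where "P = (\<Prod>j\<in>UNIV. cmod (wrap x $ j - 1))"
      have "P > 0"
        unfolding P_def using Arg2pi_wrap(2)[OF x] by (intro prod_pos) auto
      obtain N where N: "real N * P > 1"
        using reals_Archimedean3[OF \<open>P > 0\<close>] by blast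
      have "h n (wrap x) = g x" if "n \<ge> N" for n
      proof -
        have "real N * P \<le> real n * P"
          using that \<open>P > 0\<close> by (intro mult_right_mono) auto
        then have "cut n (wrap x) = 1"
          using N by (simp add: cut_def P_def)
        moreover have "(\<chi> j. Arg2pi (wrap x $ j)) = x"
          by (simp add: Arg2pi_wrap[OF x] vec_eq_iff)
        ultimately show ?thesis
          by (simp add: h_def)
      qed
      then show "\<forall>\<^sub>F n in sequentially. h n (wrap x) = g x"
        by (auto simp: eventually_sequentially)
    qed
  qed
qed

text \<open>
  A measurable function is almost everywhere the limit of continuous functions. Clamping their
  values to the disc of radius \<open>M\<close> keeps the limit and supplies the dominating constant.
\<close>

lemma trig_approximable_bounded:
  fixes v :: "real ^ 'd::finite \<Rightarrow> complex"
  assumes v: "v \<in> borel_measurable cell_measure" and M: "\<And>x. cmod (v x) \<le> M" "M > 0"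
  shows "v \<in> L2" "trig_approximable v"
proof -
  interpret finite_measure "cell_measure :: (real ^ 'd) measure"
    by (rule finite_measure_cell)
  have "integrable cell_measure (\<lambda>x. (cmod (v x))\<^sup>2)"
    using v M by (intro integrable_const_bound[where B = "M\<^sup>2"]) (auto intro!: AE_I2 power_mono)
  with v show L2: "v \<in> L2"
    by (simp add: L2_iff)
  have "v measurable_on Omega"
    using v by (simp add: measurable_on_iff_borel_measurable)
  then obtain N g where N: "negligible N" and g: "\<And>n. continuous_on UNIV (g n)"
    and lim: "\<And>x. x \<notin> N \<Longrightarrow> (\<lambda>n. g n x) \<longlonglongrightarrow> (if x \<in> Omega then v x else 0)"
    unfolding measurable_on_def by blast
  define clamp where "clamp z = (M / max M (cmod z)) *\<^sub>R z" for z :: complex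
  have pos: "max M (cmod z) > 0" for z
    using M by simp
  have clamp_le: "cmod (clamp z) \<le> M" for z
    using pos[of z] M(2) by (simp add: clamp_def divide_simps mult_left_mono)
  have clamp_id: "clamp z = z" if "cmod z \<le> M" for z
    using that M(2) by (simp add: clamp_def max_def)
  have clamp_cont: "continuous_on UNIV clamp"
    unfolding clamp_def[abs_def] using pos by (intro continuous_intros) (metis less_irrefl)
  define u where "u n x = clamp (g n x)" for n x
  have u_cont: "continuous_on UNIV (u n)" for n
    unfolding u_def[abs_def] by (intro continuous_on_compose2[OF clamp_cont g]) auto
  show "trig_approximable v"
  proof (rule trig_approximable_pointwise_limit[OF L2])
    show "u n \<in> L2" for n
      using u_cont by (rule L2_continuous)
    show "trig_approximable (u n)" for n
      using u_cont by (rule trig_approximable_continuous[where M = M]) (simp add: u_def clamp_le)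
    show "(\<lambda>x. complex_of_real (2 * M)) \<in> L2"
      by (intro L2_continuous continuous_intros)
    show "cmod (v x - u n x) \<le> cmod (complex_of_real (2 * M))" for n x
      using norm_triangle_ineq4[of "v x" "u n x"] M(1)[of x] M(2) clamp_le[of "g n x"]
      by (simp add: u_def)
    have "AE x in cell_measure. x \<notin> N"
    proof -
      have "N \<in> null_sets lebesgue"
        using N by (simp add: negligible_iff_null_sets)
      then have "AE x in lebesgue. x \<notin> N"
        by (rule AE_not_in)
      then show ?thesis
        by (subst AE_restrict_space_iff) auto
    qed
    then show "AE x in cell_measure. (\<lambda>n. u n x) \<longlonglongrightarrow> v x"
      using AE_space
    proof eventually_elim
      case (elim x)
      then have "(\<lambda>n. g n x) \<longlonglongrightarrow> v x"
        using lim[of x] by simp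
      moreover have "isCont clamp (v x)"
        using clamp_cont by (simp add: continuous_on_eq_continuous_at)
      ultimately have "(\<lambda>n. clamp (g n x)) \<longlonglongrightarrow> clamp (v x)"
        using isCont_tendsto_compose by blast
      then show ?case
        by (simp add: u_def clamp_id M(1))
    qed
  qed
qed

lemma trig_approximable_L2:
  assumes v: "v \<in> L2"
  shows "trig_approximable v"
proof -
  have [measurable]: "v \<in> borel_measurable cell_measure"
    using v by (rule L2_measurable)
  define u where "u n x = (if cmod (v x) \<le> real (Suc n) then v x else 0)" for n x
  have u: "u n \<in> borel_measurable cell_measure" "cmod (u n x) \<le> real (Suc n)" for n x
    unfolding u_def[abs_def] by auto
  show ?thesis
  proof (rule trig_approximable_pointwise_limit[OF v])
    show "u n \<in> L2" "trig_approximable (u n)" for n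
      using trig_approximable_bounded[OF u, of n] by simp_all
    show "v \<in> L2" by fact
    show "cmod (v x - u n x) \<le> cmod (v x)" for n x
      by (simp add: u_def)
    show "AE x in cell_measure. (\<lambda>n. u n x) \<longlonglongrightarrow> v x"
    proof (rule AE_I2, rule tendsto_eventually)
      fix x
      obtain N where "cmod (v x) \<le> real N"
        using real_arch_simple by blast
      then have "u n x = v x" if "n \<ge> N" for n
        using that by (simp add: u_def)
      then show "\<forall>\<^sub>F n in sequentially. u n x = v x"
        by (auto simp: eventually_sequentially)
    qed
  qed
qed

text \<open>
  Partial Fourier sums are best approximations, so the defect in Bessel's inequality is at most the
  squared distance to any trigonometric polynomial, which density makes arbitrarily small.
\<close>

theorem parseval:
  assumes v: "v \<in> L2"
  shows "((\<lambda>k. (cmod (fourier v k))\<^sup>2) has_sum l2sq v) UNIV"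
proof -
  let ?f = "\<lambda>k. (cmod (fourier v k))\<^sup>2"
  have bessel: "sum ?f F \<le> l2sq v" if "finite F" for F
    using l2sq_diff_trig_poly[OF v that, of "fourier v"]
      l2sq_nonneg[of "\<lambda>x. v x - trig_poly (fourier v) F x"] by simp
  have summable: "?f summable_on UNIV"
    by (rule nonneg_bdd_above_summable_on) (auto intro!: bdd_aboveI2 bessel)
  have "infsum ?f UNIV \<le> l2sq v"
    using summable by (rule infsum_le_finite_sums) (rule bessel)
  moreover have "l2sq v \<le> infsum ?f UNIV + e" if "e > 0" for e
  proof -
    obtain p where p: "p \<in> trig_span UNIV" "l2sq (\<lambda>x. v x - p x) < e"
      using trig_approximable_L2[OF v] \<open>e > 0\<close> unfolding trig_approximable_def by blast
    then obtain c F where F: "finite F" and "p = trig_poly c F"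
      unfolding trig_span_iff by blast
    with p have "l2sq v - sum ?f F < e"
      using l2sq_diff_trig_poly[OF v F, of c]
        sum_nonneg[of F "\<lambda>k. (cmod (fourier v k - c k))\<^sup>2"] by simp
    moreover have "sum ?f F \<le> infsum ?f UNIV"
      using summable F by (intro finite_sum_le_infsum) auto
    ultimately show ?thesis by simp
  qed
  then have "l2sq v \<le> infsum ?f UNIV"
    by (rule field_le_epsilon)
  ultimately show ?thesis
    using summable by (metis has_sum_infsum order_antisym)
qed

lemma AE_eq_if_fourier_eq:
  fixes u v :: "real ^ 'd::finite \<Rightarrow> complex"
  assumes u: "u \<in> L2" and v: "v \<in> L2" and eq: "\<And>k. fourier u k = fourier v k"
  shows "AE x in cell_measure. u x = v x"
proof -
  have "((\<lambda>k. (cmod (fourier (\<lambda>x. u x - v x) k))\<^sup>2) has_sum l2sq (\<lambda>x. u x - v x)) UNIV"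
    using u v by (intro parseval L2_diff)
  then have "((\<lambda>k :: int ^ 'd. 0 :: real) has_sum l2sq (\<lambda>x. u x - v x)) UNIV"
    by (simp add: fourier_diff u v eq)
  then have "l2sq (\<lambda>x. u x - v x) = 0"
    using has_sum_unique has_sum_0[of UNIV "\<lambda>k :: int ^ 'd. 0 :: real"] by blast
  then have "AE x in cell_measure. (cmod (u x - v x))\<^sup>2 = 0"
    unfolding l2sq_def using u v
    by (subst (asm) integral_nonneg_eq_0_iff_AE) (auto intro: L2_integrable_norm_sq L2_diff)
  then show ?thesis
    by eventually_elim simp
qed


section \<open>Weak gradients\<close>

lemma weak_gradient_iff:
  "weak_gradient v g \<longleftrightarrow>
     (\<forall>j. (\<lambda>x. g x $ j) \<in> L2 \<and>
          (\<forall>p. test_function p \<longrightarrow>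
             (\<integral>x. v x * partial j p x \<partial>cell_measure) = - (\<integral>x. g x $ j * p x \<partial>cell_measure)))"
  by (simp add: weak_gradient_def set_integral_cell)

lemma weak_gradient_L2: "weak_gradient v g \<Longrightarrow> (\<lambda>x. g x $ j) \<in> L2"
  by (simp add: weak_gradient_iff)

text \<open>
  The conjugate of an exponential is a test function.
\<close>

lemma fourier_weak_gradient:
  assumes "weak_gradient v g"
  shows "fourier (\<lambda>x. g x $ j) k = \<i> * of_int (k $ j) * fourier v k"
proof -
  have "(\<integral>x. v x * partial j (\<lambda>x. 1 * phi (- k) x) x \<partial>cell_measure) =
      - (\<integral>x. g x $ j * (1 * phi (- k) x) \<partial>cell_measure)"
    using assms test_function_phi[of 1 "- k"] unfolding weak_gradient_iff by blast
  moreover have "(\<integral>x. v x * partial j (\<lambda>x. 1 * phi (- k) x) x \<partial>cell_measure) =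
      (\<integral>x. - (\<i> * of_int (k $ j)) * (v x * phi (- k) x) \<partial>cell_measure)"
    unfolding partial_phi by (intro Bochner_Integration.integral_cong) auto
  ultimately show ?thesis
    by (simp add: fourier_eq cnj_phi)
qed

lemma test_functionD:
  assumes "test_function p"
  shows "periodic p" "p differentiable (at x)" "continuous_on UNIV p" "continuous_on UNIV (partial j p)"
proof -
  have "C_k 0 p" "C_k 1 p"
    using assms unfolding test_function_def by blast+
  then show "p differentiable (at x)" "continuous_on UNIV p" "continuous_on UNIV (partial j p)"
    by simp_all
  show "periodic p"
    using assms by (simp add: test_function_def)
qed

lemma L2_integrable_mult_continuous:
  fixes p :: "real ^ 'd::finite \<Rightarrow> complex"
  assumes "v \<in> L2" "continuous_on UNIV p"
  shows "integrable cell_measure (\<lambda>x. v x * p x)"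
proof -
  have "(\<lambda>x. cnj (p x)) \<in> L2"
    by (intro L2_continuous continuous_intros assms)
  from L2_integrable_mult_cnj[OF assms(1) this] show ?thesis
    by simp
qed

lemma weak_gradient_add:
  assumes "u \<in> L2" "v \<in> L2" "weak_gradient u g" "weak_gradient v h"
  shows "weak_gradient (\<lambda>x. u x + v x) (\<lambda>x. g x + h x)"
proof -
  have "(\<lambda>x. g x $ j) \<in> L2" "(\<lambda>x. h x $ j) \<in> L2" for j
    using assms by (auto intro: weak_gradient_L2)
  then show ?thesis
    using assms unfolding weak_gradient_iff
    by (auto simp: L2_add ring_distribs L2_integrable_mult_continuous test_functionD)
qed

lemma weak_gradient_cmult:
  assumes "weak_gradient u g"
  shows "weak_gradient (\<lambda>x. c * u x) (\<lambda>x. c *s g x)"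
  using assms unfolding weak_gradient_iff by (auto simp: L2_cmult mult.assoc)

lemma has_derivative_trig_poly:
  "(trig_poly c F has_derivative (\<lambda>h. \<Sum>k\<in>F. c k * \<i> * of_real (freq k \<bullet> h) * phi k x)) (at x within S)"
  unfolding trig_poly_def[abs_def] by (intro has_derivative_sum has_derivative_phi)

lemma partial_trig_poly:
  "partial j (trig_poly c F) = trig_poly (\<lambda>k. c k * \<i> * of_int (k $ j)) F"
proof
  fix x
  have "frechet_derivative (trig_poly c F) (at x) =
      (\<lambda>h. \<Sum>k\<in>F. c k * \<i> * of_real (freq k \<bullet> h) * phi k x)"
    using has_derivative_trig_poly by (rule frechet_derivative_at[symmetric])
  then show "partial j (trig_poly c F) x = trig_poly (\<lambda>k. c k * \<i> * of_int (k $ j)) F x"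
    by (simp add: partial_def trig_poly_def inner_axis freq_def)
qed

lemma periodic_trig_poly: "periodic (trig_poly c F)"
  unfolding periodic_def trig_poly_def
  by (intro allI sum.cong refl) (simp add: periodic_phi[unfolded periodic_def])

text \<open>
  Integration by parts without boundary terms: the product with a periodic test function is
  periodic, and its partial derivative has mean zero.
\<close>

lemma weak_gradient_trig_poly:
  fixes c :: "int ^ 'd::finite \<Rightarrow> complex"
  shows "weak_gradient (trig_poly c F) (\<lambda>x. \<chi> j. partial j (trig_poly c F) x)"
  unfolding weak_gradient_iff
proof (intro allI conjI impI)
  let ?w = "trig_poly c F"
  show "(\<lambda>x. (\<chi> j. partial j ?w x) $ j) \<in> L2" for j
    by (simp add: partial_trig_poly trig_poly_in_L2)
  fix j p assume p: "test_function (p :: real ^ 'd \<Rightarrow> complex)"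
  have wd: "?w differentiable (at x)" for x
    using has_derivative_trig_poly[of c F x UNIV] unfolding differentiable_def by blast
  have part: "partial j (\<lambda>x. ?w x * p x) x = ?w x * partial j p x + partial j ?w x * p x" for x
  proof -
    have "((\<lambda>x. ?w x * p x) has_derivative
        (\<lambda>h. ?w x * frechet_derivative p (at x) h + frechet_derivative ?w (at x) h * p x)) (at x)"
      using wd test_functionD(2)[OF p] by (intro has_derivative_mult) (simp_all add: frechet_derivative_works)
    from frechet_derivative_at[OF this, symmetric] show ?thesis
      by (simp add: partial_def)
  qed
  have c1: "continuous_on UNIV (\<lambda>x. ?w x * partial j p x)"
    by (intro continuous_intros test_functionD(4)[OF p])
  have c2: "continuous_on UNIV (\<lambda>x. partial j ?w x * p x)"
    unfolding partial_trig_poly by (intro continuous_intros test_functionD(3)[OF p])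
  have "(\<integral>x. partial j (\<lambda>x. ?w x * p x) x \<partial>cell_measure) = 0"
  proof (rule integral_cell_partial)
    show "periodic (\<lambda>x. ?w x * p x)"
      by (intro periodic_mult periodic_trig_poly test_functionD(1)[OF p])
    show "(\<lambda>x. ?w x * p x) differentiable (at x)" for x
      by (intro differentiable_mult wd test_functionD(2)[OF p])
    show "continuous_on UNIV (partial j (\<lambda>x. ?w x * p x))"
      unfolding part[abs_def] by (intro continuous_on_add c1 c2)
  qed
  then have "(\<integral>x. ?w x * partial j p x \<partial>cell_measure) + (\<integral>x. partial j ?w x * p x \<partial>cell_measure) = 0"
    unfolding part using integrable_continuous_cell[OF c1] integrable_continuous_cell[OF c2] by simp
  then show "(\<integral>x. ?w x * partial j p x \<partial>cell_measure) =
      - (\<integral>x. (\<chi> j. partial j ?w x) $ j * p x \<partial>cell_measure)"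
    by (simp add: eq_neg_iff_add_eq_0)
qed

lemma H1p_L2: "v \<in> H1p \<Longrightarrow> v \<in> L2"
  by (simp add: H1p_def)

lemma weak_gradient_grad: "v \<in> H1p \<Longrightarrow> weak_gradient v (grad v)"
  unfolding grad_def H1p_def by (auto intro: someI_ex[of "weak_gradient v"])

lemma grad_L2: "v \<in> H1p \<Longrightarrow> (\<lambda>x. grad v x $ j) \<in> L2"
  using weak_gradient_grad weak_gradient_L2 by blast

lemma fourier_grad: "v \<in> H1p \<Longrightarrow> fourier (\<lambda>x. grad v x $ j) k = \<i> * of_int (k $ j) * fourier v k"
  using weak_gradient_grad fourier_weak_gradient by blast

lemma H1p_add: "u \<in> H1p \<Longrightarrow> v \<in> H1p \<Longrightarrow> (\<lambda>x. u x + v x) \<in> H1p"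
  using weak_gradient_add[OF H1p_L2 H1p_L2 weak_gradient_grad weak_gradient_grad, of u v]
  unfolding H1p_def by (auto simp: periodic_def L2_add)

lemma H1p_cmult: "u \<in> H1p \<Longrightarrow> (\<lambda>x. c * u x) \<in> H1p"
  using weak_gradient_cmult[OF weak_gradient_grad, of u c]
  unfolding H1p_def by (auto simp: periodic_def L2_cmult)

lemma H1p_diff: "u \<in> H1p \<Longrightarrow> v \<in> H1p \<Longrightarrow> (\<lambda>x. u x - v x) \<in> H1p"
  using H1p_add[OF _ H1p_cmult[of v "-1"]] by simp

lemma trig_poly_in_H1p: "trig_poly c F \<in> H1p"
  unfolding H1p_def using periodic_trig_poly trig_poly_in_L2 weak_gradient_trig_poly by blast

lemma trig_span_in_H1p: "v \<in> trig_span \<Lambda> \<Longrightarrow> v \<in> H1p"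
  by (auto simp: trig_span_iff trig_poly_in_H1p)

text \<open>
  The gradient is an arbitrary choice among weak gradients, hence linear only almost everywhere;
  all choices have the same Fourier coefficients.
\<close>

lemma AE_grad_add:
  assumes "u \<in> H1p" "v \<in> H1p"
  shows "AE x in cell_measure. grad (\<lambda>x. u x + v x) x $ j = grad u x $ j + grad v x $ j"
  using assms
  by (intro AE_eq_if_fourier_eq grad_L2 L2_add H1p_add)
     (simp_all add: fourier_grad H1p_add fourier_add grad_L2 H1p_L2 ring_distribs)

lemma AE_grad_cmult:
  assumes "u \<in> H1p"
  shows "AE x in cell_measure. grad (\<lambda>x. c * u x) x $ j = c * grad u x $ j"
  using assms
  by (intro AE_eq_if_fourier_eq grad_L2 L2_cmult H1p_cmult)
     (simp_all add: fourier_grad H1p_cmult fourier_cmult)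

section \<open>The Sobolev norm\<close>

text \<open>
  The squared Sobolev norm in integral form, without the Fourier series.
\<close>

definition h1sq :: "(real ^ 'd::finite \<Rightarrow> complex) \<Rightarrow> real" where
  "h1sq v = (\<Sum>j\<in>UNIV. l2sq (\<lambda>x. grad v x $ j)) + l2sq v"

lemma h1sq_nonneg [simp]: "0 \<le> h1sq v"
  by (simp add: h1sq_def sum_nonneg)

lemma h1sq_has_sum:
  fixes v :: "real ^ 'd::finite \<Rightarrow> complex"
  assumes v: "v \<in> H1p"
  shows "((\<lambda>k. (1 + (norm (freq k))\<^sup>2) * (cmod (fourier v k))\<^sup>2) has_sum h1sq v) UNIV"
proof -
  have "((\<lambda>k. \<Sum>j\<in>J. (cmod (fourier (\<lambda>x. grad v x $ j) k))\<^sup>2) has_sum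
      (\<Sum>j\<in>J. l2sq (\<lambda>x. grad v x $ j))) UNIV" if "finite J" for J
    using that by (induction J) (auto intro!: has_sum_add parseval grad_L2 v)
  then have "((\<lambda>k. (\<Sum>j\<in>UNIV. (cmod (fourier (\<lambda>x. grad v x $ j) k))\<^sup>2) + (cmod (fourier v k))\<^sup>2)
      has_sum h1sq v) UNIV"
    unfolding h1sq_def using v by (intro has_sum_add parseval H1p_L2) auto
  moreover have "(\<Sum>j\<in>UNIV. (cmod (fourier (\<lambda>x. grad v x $ j) k))\<^sup>2) + (cmod (fourier v k))\<^sup>2 =
      (1 + (norm (freq k))\<^sup>2) * (cmod (fourier v k))\<^sup>2" for k
  proof -
    have "(norm (freq k))\<^sup>2 = (\<Sum>j\<in>UNIV. (real_of_int (k $ j))\<^sup>2)"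
      unfolding power2_norm_eq_inner inner_vec_def by (simp add: freq_def power2_eq_square)
    then show ?thesis
      using v by (simp add: fourier_grad norm_mult power_mult_distrib sum_distrib_right ring_distribs)
  qed
  ultimately show ?thesis
    by simp
qed

lemma H1_norm_eq: "v \<in> H1p \<Longrightarrow> H1_norm v = sqrt (h1sq v)"
  using infsumI[OF h1sq_has_sum[of v]] by (simp add: H1_norm_def)

lemma H1_norm_nonneg: "v \<in> H1p \<Longrightarrow> 0 \<le> H1_norm v"
  by (simp add: H1_norm_eq)

lemma H1_norm_sq: "v \<in> H1p \<Longrightarrow> (H1_norm v)\<^sup>2 = h1sq v"
  by (simp add: H1_norm_eq)

lemma H1_norm_mono:
  assumes "u \<in> H1p" "v \<in> H1p" "\<And>k. cmod (fourier u k) \<le> cmod (fourier v k)"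
  shows "H1_norm u \<le> H1_norm v"
proof -
  have "h1sq u \<le> h1sq v"
    using h1sq_has_sum[OF assms(1)] h1sq_has_sum[OF assms(2)]
    by (rule has_sum_mono) (use assms(3) in \<open>auto intro!: mult_left_mono power_mono\<close>)
  then show ?thesis
    using assms by (simp add: H1_norm_eq)
qed

lemma proj_eq: "proj \<Lambda> v = trig_poly (fourier v) \<Lambda>"
  by (simp add: proj_def trig_poly_def fun_eq_iff)

lemma proj_in_H1p: "proj \<Lambda> v \<in> H1p"
  by (simp add: proj_eq trig_poly_in_H1p)

lemma fourier_diff_proj:
  assumes "v \<in> L2" "finite \<Lambda>"
  shows "fourier (\<lambda>x. v x - proj \<Lambda> v x) k = (if k \<in> \<Lambda> then 0 else fourier v k)"
  using assms by (simp add: proj_eq fourier_diff trig_poly_in_L2 fourier_trig_poly)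

text \<open>
  Removing frequencies never increases the norm.
\<close>

lemma H1_norm_diff_proj_le:
  assumes "v \<in> H1p" "finite \<Lambda>"
  shows "H1_norm (\<lambda>x. v x - proj \<Lambda> v x) \<le> H1_norm v"
  using assms by (intro H1_norm_mono H1p_diff proj_in_H1p) (simp_all add: fourier_diff_proj H1p_L2)

lemma h1sq_diff_proj:
  assumes v: "v \<in> H1p" and F: "finite F"
  shows "h1sq (\<lambda>x. v x - proj F v x) =
    h1sq v - (\<Sum>k\<in>F. (1 + (norm (freq k))\<^sup>2) * (cmod (fourier v k))\<^sup>2)"
proof -
  let ?f = "\<lambda>k. (1 + (norm (freq k))\<^sup>2) * (cmod (fourier v k))\<^sup>2"
  have "((\<lambda>k. if k \<in> F then - ?f k else 0) has_sum (\<Sum>k\<in>F. - ?f k)) UNIV"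
    by (rule has_sum_finite_neutralI[OF F]) auto
  from has_sum_add[OF h1sq_has_sum[OF v] this]
  have "((\<lambda>k. ?f k + (if k \<in> F then - ?f k else 0)) has_sum h1sq v - sum ?f F) UNIV"
    by (simp add: sum_negf)
  moreover have "(\<lambda>k. ?f k + (if k \<in> F then - ?f k else 0)) =
      (\<lambda>k. (1 + (norm (freq k))\<^sup>2) * (cmod (fourier (\<lambda>x. v x - proj F v x) k))\<^sup>2)"
    using v F by (auto simp: fourier_diff_proj H1p_L2)
  ultimately have "((\<lambda>k. (1 + (norm (freq k))\<^sup>2) * (cmod (fourier (\<lambda>x. v x - proj F v x) k))\<^sup>2)
      has_sum h1sq v - sum ?f F) UNIV"
    by simp
  moreover have "(\<lambda>x. v x - proj F v x) \<in> H1p"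
    using v by (intro H1p_diff proj_in_H1p)
  note h1sq_has_sum[OF this]
  ultimately show ?thesis
    using has_sum_unique by blast
qed

lemma h1sq_trig_poly:
  assumes F: "finite F"
  shows "h1sq (trig_poly c F) = (\<Sum>k\<in>F. (1 + (norm (freq k))\<^sup>2) * (cmod (c k))\<^sup>2)"
proof -
  let ?f = "\<lambda>k. (1 + (norm (freq k))\<^sup>2) * (cmod (fourier (trig_poly c F) k))\<^sup>2"
  have "(?f has_sum sum ?f F) UNIV"
    by (rule has_sum_finite_neutralI[OF F]) (auto simp: fourier_trig_poly F)
  then have "h1sq (trig_poly c F) = sum ?f F"
    using h1sq_has_sum[OF trig_poly_in_H1p] has_sum_unique by blast
  then show ?thesis
    by (simp add: fourier_trig_poly F)
qed

lemma H1_norm_diff_proj_small: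
  fixes v :: "real ^ 'd::finite \<Rightarrow> complex"
  assumes v: "v \<in> H1p" and e: "e > 0"
  shows "\<exists>F. finite F \<and> H1_norm (\<lambda>x. v x - proj F v x) < e"
proof -
  let ?f = "\<lambda>k. (1 + (norm (freq k))\<^sup>2) * (cmod (fourier v k))\<^sup>2"
  obtain F where F: "finite F" "dist (sum ?f F) (h1sq v) \<le> e\<^sup>2 / 2"
    using has_sum_finite_approximation[OF h1sq_has_sum[OF v], of "e\<^sup>2 / 2"] e by auto
  then have "h1sq (\<lambda>x. v x - proj F v x) \<le> e\<^sup>2 / 2"
    unfolding h1sq_diff_proj[OF v F(1)] dist_real_def by linarith
  also have "\<dots> < e\<^sup>2"
    using e by simp
  finally have "H1_norm (\<lambda>x. v x - proj F v x) < e"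
    using e v by (simp add: H1_norm_eq H1p_diff proj_in_H1p real_less_lsqrt)
  then show ?thesis
    using F by blast
qed


section \<open>Weighted inner products\<close>

definition weighted_inner ::
  "(real ^ 'd::finite \<Rightarrow> real) \<Rightarrow> (real ^ 'd \<Rightarrow> complex) \<Rightarrow> (real ^ 'd \<Rightarrow> complex) \<Rightarrow> complex" where
  "weighted_inner c f g = (\<integral>x. of_real (c x) * (f x * cnj (g x)) \<partial>cell_measure)"

locale bounded_weight =
  fixes c :: "real ^ 'd::finite \<Rightarrow> real" and lo hi :: real
  assumes cont: "continuous_on UNIV c" and lo_nonneg: "0 \<le> lo"
    and bounds: "lo \<le> c x" "c x \<le> hi"
begin

lemma measurable_weight: "(\<lambda>x. complex_of_real (c x)) \<in> borel_measurable cell_measure"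
proof -
  have "integrable cell_measure (\<lambda>x. complex_of_real (c x))"
    by (intro integrable_continuous_cell continuous_intros cont)
  then show ?thesis by auto
qed

lemma integrable_weighted:
  assumes "f \<in> L2" "g \<in> L2"
  shows "integrable cell_measure (\<lambda>x. of_real (c x) * (f x * cnj (g x)))"
proof (rule Bochner_Integration.integrable_bound)
  show "integrable cell_measure (\<lambda>x. of_real hi * (f x * cnj (g x)))"
    using L2_integrable_mult_cnj[OF assms] by simp
  have [measurable]: "(\<lambda>x. f x * cnj (g x)) \<in> borel_measurable cell_measure"
    using L2_integrable_mult_cnj[OF assms] by auto
  show "(\<lambda>x. of_real (c x) * (f x * cnj (g x))) \<in> borel_measurable cell_measure"
    using measurable_weight by measurable
  have "\<bar>c x\<bar> \<le> \<bar>hi\<bar>" for x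
    using bounds[of x] lo_nonneg by linarith
  then show "AE x in cell_measure. norm (of_real (c x) * (f x * cnj (g x))) \<le> norm (of_real hi * (f x * cnj (g x)))"
    by (intro AE_I2) (simp add: norm_mult mult_right_mono)
qed

lemma weighted_inner_add:
  assumes "f \<in> L2" "g \<in> L2" "h \<in> L2"
  shows "weighted_inner c (\<lambda>x. f x + g x) h = weighted_inner c f h + weighted_inner c g h"
  unfolding weighted_inner_def using integrable_weighted assms by (simp add: ring_distribs)

lemma weighted_inner_cmult: "weighted_inner c (\<lambda>x. a * f x) h = a * weighted_inner c f h"
proof -
  have "weighted_inner c (\<lambda>x. a * f x) h = (\<integral>x. a * (of_real (c x) * (f x * cnj (h x))) \<partial>cell_measure)"
    unfolding weighted_inner_def by (intro Bochner_Integration.integral_cong) auto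
  then show ?thesis
    by (simp add: weighted_inner_def)
qed

lemma weighted_inner_cnj: "weighted_inner c g f = cnj (weighted_inner c f g)"
proof -
  have "cnj (weighted_inner c f g) = (\<integral>x. cnj (of_real (c x) * (f x * cnj (g x))) \<partial>cell_measure)"
    unfolding weighted_inner_def by (rule Bochner_Integration.integral_cnj[symmetric])
  then show ?thesis
    by (simp add: weighted_inner_def mult.commute)
qed

lemma weighted_inner_cong_AE:
  assumes "f \<in> L2" "f' \<in> L2" "g \<in> L2" "AE x in cell_measure. f x = f' x"
  shows "weighted_inner c f g = weighted_inner c f' g"
  unfolding weighted_inner_def
proof (rule integral_cong_AE)
  show "AE x in cell_measure. of_real (c x) * (f x * cnj (g x)) = of_real (c x) * (f' x * cnj (g x))"
    using assms(4) by eventually_elim simp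
qed (use integrable_weighted assms in auto)

lemma weighted_inner_self:
  assumes "f \<in> L2"
  shows "lo * l2sq f \<le> Re (weighted_inner c f f)" "Re (weighted_inner c f f) \<le> hi * l2sq f"
proof -
  have eq: "Re (of_real (c x) * (f x * cnj (f x))) = c x * (cmod (f x))\<^sup>2" for x
    by (simp add: cmod_power2) (simp add: power2_eq_square)
  have int: "integrable cell_measure (\<lambda>x. c x * (cmod (f x))\<^sup>2)"
    using integrable_Re[OF integrable_weighted[OF assms assms]] by (simp only: eq)
  have "Re (weighted_inner c f f) = (\<integral>x. c x * (cmod (f x))\<^sup>2 \<partial>cell_measure)"
    unfolding weighted_inner_def integral_Re[OF integrable_weighted[OF assms assms], symmetric] eq ..
  moreover have "(\<integral>x. lo * (cmod (f x))\<^sup>2 \<partial>cell_measure) \<le> (\<integral>x. c x * (cmod (f x))\<^sup>2 \<partial>cell_measure)"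
    using int L2_integrable_norm_sq[OF assms] bounds by (intro integral_mono) (auto intro: mult_right_mono)
  moreover have "(\<integral>x. c x * (cmod (f x))\<^sup>2 \<partial>cell_measure) \<le> (\<integral>x. hi * (cmod (f x))\<^sup>2 \<partial>cell_measure)"
    using int L2_integrable_norm_sq[OF assms] bounds by (intro integral_mono) (auto intro: mult_right_mono)
  ultimately show "lo * l2sq f \<le> Re (weighted_inner c f f)" "Re (weighted_inner c f f) \<le> hi * l2sq f"
    by (simp_all add: l2sq_def)
qed

end


section \<open>The elliptic form\<close>

text \<open>
  Both coefficients share the bounds: \<open>lo\<close> is a coercivity constant and \<open>hi\<close> a continuity constant
  of the form.
\<close>

locale elliptic =
  fixes \<nu> \<sigma> :: "real ^ 'd::finite \<Rightarrow> real" and lo hi :: real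
  assumes cont_\<nu>: "continuous_on UNIV \<nu>" and cont_\<sigma>: "continuous_on UNIV \<sigma>" and lo_pos: "0 < lo"
    and bounds_\<nu>: "lo \<le> \<nu> x" "\<nu> x \<le> hi" and bounds_\<sigma>: "lo \<le> \<sigma> x" "\<sigma> x \<le> hi"
begin

sublocale diffusion: bounded_weight \<nu> lo hi
  using cont_\<nu> lo_pos bounds_\<nu> by unfold_locales auto

sublocale reaction: bounded_weight \<sigma> lo hi
  using cont_\<sigma> lo_pos bounds_\<sigma> by unfold_locales auto

lemma bilin_eq:
  assumes "u \<in> H1p" "v \<in> H1p"
  shows "bilin \<nu> \<sigma> u v =
    (\<Sum>j\<in>UNIV. weighted_inner \<nu> (\<lambda>x. grad u x $ j) (\<lambda>x. grad v x $ j)) + weighted_inner \<sigma> u v"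
proof -
  have "(\<integral>x. of_real (\<nu> x) * (\<Sum>j\<in>UNIV. grad u x $ j * cnj (grad v x $ j)) \<partial>cell_measure) =
      (\<Sum>j\<in>UNIV. weighted_inner \<nu> (\<lambda>x. grad u x $ j) (\<lambda>x. grad v x $ j))"
    unfolding sum_distrib_left weighted_inner_def
    using assms by (intro Bochner_Integration.integral_sum diffusion.integrable_weighted grad_L2)
  then show ?thesis
    by (simp add: bilin_def set_integral_cell weighted_inner_def mult.assoc)
qed

lemma bilin_cnj:
  assumes "u \<in> H1p" "v \<in> H1p"
  shows "bilin \<nu> \<sigma> v u = cnj (bilin \<nu> \<sigma> u v)"
proof -
  have "weighted_inner \<nu> (\<lambda>x. grad v x $ j) (\<lambda>x. grad u x $ j) =
      cnj (weighted_inner \<nu> (\<lambda>x. grad u x $ j) (\<lambda>x. grad v x $ j))" for j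
    by (rule diffusion.weighted_inner_cnj)
  moreover have "weighted_inner \<sigma> v u = cnj (weighted_inner \<sigma> u v)"
    by (rule reaction.weighted_inner_cnj)
  ultimately show ?thesis
    unfolding bilin_eq[OF assms] bilin_eq[OF assms(2,1)] by (simp only: complex_cnj_add cnj_sum)
qed

lemma bilin_add_left:
  assumes "u \<in> H1p" "v \<in> H1p" "w \<in> H1p"
  shows "bilin \<nu> \<sigma> (\<lambda>x. u x + v x) w = bilin \<nu> \<sigma> u w + bilin \<nu> \<sigma> v w"
proof -
  have "weighted_inner \<nu> (\<lambda>x. grad (\<lambda>x. u x + v x) x $ j) (\<lambda>x. grad w x $ j) =
      weighted_inner \<nu> (\<lambda>x. grad u x $ j + grad v x $ j) (\<lambda>x. grad w x $ j)" for j
    using assms by (intro diffusion.weighted_inner_cong_AE grad_L2 H1p_add L2_add AE_grad_add)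
  then show ?thesis
    using assms
    by (simp add: bilin_eq H1p_add diffusion.weighted_inner_add reaction.weighted_inner_add
        grad_L2 H1p_L2 sum.distrib)
qed

lemma bilin_cmult_left:
  assumes "u \<in> H1p" "w \<in> H1p"
  shows "bilin \<nu> \<sigma> (\<lambda>x. a * u x) w = a * bilin \<nu> \<sigma> u w"
proof -
  have "weighted_inner \<nu> (\<lambda>x. grad (\<lambda>x. a * u x) x $ j) (\<lambda>x. grad w x $ j) =
      weighted_inner \<nu> (\<lambda>x. a * grad u x $ j) (\<lambda>x. grad w x $ j)" for j
    using assms by (intro diffusion.weighted_inner_cong_AE grad_L2 H1p_cmult L2_cmult AE_grad_cmult)
  then show ?thesis
    using assms
    by (simp add: bilin_eq H1p_cmult diffusion.weighted_inner_cmult reaction.weighted_inner_cmult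
        sum_distrib_left ring_distribs)
qed

lemma bilin_diff_left:
  assumes "u \<in> H1p" "v \<in> H1p" "w \<in> H1p"
  shows "bilin \<nu> \<sigma> (\<lambda>x. u x - v x) w = bilin \<nu> \<sigma> u w - bilin \<nu> \<sigma> v w"
  using bilin_add_left[OF assms(1) H1p_cmult[OF assms(2), of "-1"] assms(3)]
    bilin_cmult_left[OF assms(2,3), of "-1"] by simp

lemma bilin_add_right:
  assumes "u \<in> H1p" "v \<in> H1p" "w \<in> H1p"
  shows "bilin \<nu> \<sigma> w (\<lambda>x. u x + v x) = bilin \<nu> \<sigma> w u + bilin \<nu> \<sigma> w v"
  unfolding bilin_cnj[OF assms(1,3)] bilin_cnj[OF assms(2,3)] bilin_cnj[OF H1p_add[OF assms(1,2)] assms(3)]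
  by (simp add: bilin_add_left assms)

lemma bilin_cmult_right:
  assumes "u \<in> H1p" "w \<in> H1p"
  shows "bilin \<nu> \<sigma> w (\<lambda>x. a * u x) = cnj a * bilin \<nu> \<sigma> w u"
  unfolding bilin_cnj[OF assms] bilin_cnj[OF H1p_cmult[OF assms(1)] assms(2)]
  by (simp add: bilin_cmult_left assms)

lemma bilin_diff_right:
  assumes "u \<in> H1p" "v \<in> H1p" "w \<in> H1p"
  shows "bilin \<nu> \<sigma> w (\<lambda>x. u x - v x) = bilin \<nu> \<sigma> w u - bilin \<nu> \<sigma> w v"
  unfolding bilin_cnj[OF assms(1,3)] bilin_cnj[OF assms(2,3)] bilin_cnj[OF H1p_diff[OF assms(1,2)] assms(3)]
  by (simp add: bilin_diff_left assms)

lemma bilin_self_bounds: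
  assumes "v \<in> H1p"
  shows "lo * h1sq v \<le> Re (bilin \<nu> \<sigma> v v)" "Re (bilin \<nu> \<sigma> v v) \<le> hi * h1sq v"
  by (auto simp: bilin_eq[OF assms assms] h1sq_def sum_distrib_left ring_distribs
      intro!: add_mono sum_mono diffusion.weighted_inner_self[OF grad_L2[OF assms]]
        reaction.weighted_inner_self[OF H1p_L2[OF assms]])

lemma bilin_self_nonneg:
  assumes "v \<in> H1p"
  shows "0 \<le> Re (bilin \<nu> \<sigma> v v)"
proof -
  have "0 \<le> lo * h1sq v"
    using lo_pos by simp
  then show ?thesis
    using bilin_self_bounds(1)[OF assms] by linarith
qed

lemma energy_diff:
  assumes "u \<in> H1p" "v \<in> H1p"
  shows "Re (bilin \<nu> \<sigma> (\<lambda>x. u x - v x) (\<lambda>x. u x - v x)) =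
    Re (bilin \<nu> \<sigma> u u) - 2 * Re (bilin \<nu> \<sigma> u v) + Re (bilin \<nu> \<sigma> v v)"
  using assms bilin_cnj[OF assms] by (simp add: bilin_diff_left bilin_diff_right H1p_diff)

text \<open>
  The energy of \<open>u - s b v\<close> with \<open>b = a(u,v)\<close> is a nonnegative quadratic polynomial in the real
  variable \<open>s\<close>.
\<close>

lemma cauchy_schwarz:
  assumes u: "u \<in> H1p" and v: "v \<in> H1p"
  shows "(cmod (bilin \<nu> \<sigma> u v))\<^sup>2 \<le> Re (bilin \<nu> \<sigma> u u) * Re (bilin \<nu> \<sigma> v v)"
proof -
  define b where "b = bilin \<nu> \<sigma> u v"
  define A where "A = Re (bilin \<nu> \<sigma> u u)"
  define B where "B = Re (bilin \<nu> \<sigma> v v)"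
  have quadratic: "0 \<le> A - 2 * s * (cmod b)\<^sup>2 + s\<^sup>2 * (cmod b)\<^sup>2 * B" for s :: real
  proof -
    have re_scale: "Re (of_real q * z) = q * Re z" for q z
      by simp
    define a where "a = of_real s * b"
    have c: "(\<lambda>x. a * v x) \<in> H1p"
      using v by (rule H1p_cmult)
    have "Re (bilin \<nu> \<sigma> u (\<lambda>x. a * v x)) = Re (cnj a * b)"
      by (simp only: bilin_cmult_right[OF v u] b_def)
    also have "\<dots> = s * (cmod b)\<^sup>2"
      by (simp add: cmod_power2 a_def) (simp add: power2_eq_square algebra_simps)
    finally have cross: "Re (bilin \<nu> \<sigma> u (\<lambda>x. a * v x)) = s * (cmod b)\<^sup>2" .
    have "bilin \<nu> \<sigma> (\<lambda>x. a * v x) (\<lambda>x. a * v x) = (a * cnj a) * bilin \<nu> \<sigma> v v"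
      by (simp only: bilin_cmult_left[OF v c] bilin_cmult_right[OF v v] mult.assoc)
    also have "a * cnj a = of_real (s\<^sup>2) * (b * cnj b)"
      by (simp add: a_def power2_eq_square)
    also have "\<dots> = of_real (s\<^sup>2 * (cmod b)\<^sup>2)"
      by (simp only: complex_norm_square[symmetric] of_real_mult)
    finally have square: "Re (bilin \<nu> \<sigma> (\<lambda>x. a * v x) (\<lambda>x. a * v x)) = s\<^sup>2 * (cmod b)\<^sup>2 * B"
      by (simp only: re_scale B_def)
    show ?thesis
      using bilin_self_nonneg[OF H1p_diff[OF u c]] unfolding energy_diff[OF u c] cross square A_def
      by simp
  qed
  have "A \<ge> 0" "B \<ge> 0"
    using bilin_self_nonneg u v by (simp_all add: A_def B_def)
  have "(cmod b)\<^sup>2 \<le> A * B"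
  proof (cases "B = 0")
    case True
    have "(cmod b)\<^sup>2 = 0"
    proof (rule ccontr)
      assume "(cmod b)\<^sup>2 \<noteq> 0"
      then show False
        \<comment> \<open>without its quadratic term the polynomial takes the value \<open>-1\<close> here\<close>
        using quadratic[of "(A + 1) / (2 * (cmod b)\<^sup>2)"] True by simp
    qed
    then show ?thesis
      using True by simp
  next
    case False
    then show ?thesis
      using quadratic[of "1 / B"] \<open>B \<ge> 0\<close> by (simp add: field_simps power2_eq_square)
  qed
  then show ?thesis
    by (simp add: A_def B_def b_def)
qed

lemma lo_le_hi: "lo \<le> hi"
  using bounds_\<nu>[of 0] by simp

lemma bilin_bounded:
  assumes u: "u \<in> H1p" and v: "v \<in> H1p"
  shows "cmod (bilin \<nu> \<sigma> u v) \<le> hi * H1_norm u * H1_norm v"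
proof (rule power2_le_imp_le)
  have "(cmod (bilin \<nu> \<sigma> u v))\<^sup>2 \<le> Re (bilin \<nu> \<sigma> u u) * Re (bilin \<nu> \<sigma> v v)"
    using u v by (rule cauchy_schwarz)
  also have "\<dots> \<le> (hi * h1sq u) * (hi * h1sq v)"
    using lo_pos lo_le_hi u v by (intro mult_mono bilin_self_bounds bilin_self_nonneg) auto
  also have "\<dots> = (hi * H1_norm u * H1_norm v)\<^sup>2"
    using u v by (simp add: power_mult_distrib H1_norm_sq power2_eq_square[of hi])
  finally show "(cmod (bilin \<nu> \<sigma> u v))\<^sup>2 \<le> (hi * H1_norm u * H1_norm v)\<^sup>2" .
  show "0 \<le> hi * H1_norm u * H1_norm v"
    using lo_pos lo_le_hi u v by (auto intro!: mult_nonneg_nonneg H1_norm_nonneg)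
qed

text \<open>
  By Galerkin orthogonality, the energy of \<open>u - z\<close> is the energy of \<open>u - x\<close> plus that of \<open>z - x\<close>.
  Using the symmetry of the form in this way gives the square root of the condition number.
\<close>

lemma cea:
  assumes u: "u \<in> H1p" and x: "x \<in> trig_span \<Lambda>" and z: "z \<in> trig_span \<Lambda>"
    and orth: "\<And>y. y \<in> trig_span \<Lambda> \<Longrightarrow> bilin \<nu> \<sigma> (\<lambda>t. u t - x t) y = 0"
  shows "H1_norm (\<lambda>t. u t - x t) \<le> sqrt (hi / lo) * H1_norm (\<lambda>t. u t - z t)"
proof -
  let ?e = "\<lambda>t. u t - x t" and ?y = "\<lambda>t. z t - x t"
  have y: "?y \<in> trig_span \<Lambda>"
    using z x by (rule trig_span_diff)
  have H: "?e \<in> H1p" "?y \<in> H1p" "(\<lambda>t. u t - z t) \<in> H1p"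
    using u x z y by (auto intro: H1p_diff trig_span_in_H1p)
  have "(\<lambda>t. u t - z t) = (\<lambda>t. ?e t - ?y t)"
    by simp
  then have "Re (bilin \<nu> \<sigma> (\<lambda>t. u t - z t) (\<lambda>t. u t - z t)) = Re (bilin \<nu> \<sigma> ?e ?e) + Re (bilin \<nu> \<sigma> ?y ?y)"
    using energy_diff[OF H(1,2)] orth[OF y] by (simp only:) simp
  then have "lo * h1sq ?e \<le> hi * h1sq (\<lambda>t. u t - z t)"
    using bilin_self_bounds[OF H(1)] bilin_self_bounds[OF H(3)] bilin_self_nonneg[OF H(2)] by linarith
  then have "h1sq ?e \<le> hi / lo * h1sq (\<lambda>t. u t - z t)"
    using lo_pos by (simp add: field_simps)
  then show ?thesis
    using H by (simp add: H1_norm_eq real_sqrt_mult[symmetric])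
qed

end

lemma (in elliptic) galerkin_quasi_optimal:
  assumes sol: "weak_solution \<nu> \<sigma> f u" and gal: "galerkin \<nu> \<sigma> f \<Lambda> x" and z: "z \<in> trig_span \<Lambda>"
  shows "H1_norm (\<lambda>t. u t - x t) \<le> sqrt (hi / lo) * H1_norm (\<lambda>t. u t - z t)"
proof (rule cea[OF _ _ z])
  show u: "u \<in> H1p" and x: "x \<in> trig_span \<Lambda>"
    using sol gal by (simp_all add: weak_solution_def galerkin_def)
  show "bilin \<nu> \<sigma> (\<lambda>t. u t - x t) y = 0" if y: "y \<in> trig_span \<Lambda>" for y
    using sol gal y trig_span_in_H1p[OF y] u trig_span_in_H1p[OF x]
    by (simp add: bilin_diff_left weak_solution_def galerkin_def)
qed

text \<open>
  With unit coefficients the form is the Sobolev inner product, so its Cauchy-Schwarz inequality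
  yields the triangle inequality for the norm.
\<close>

interpretation sobolev: elliptic "\<lambda>_. 1" "\<lambda>_. 1" 1 1
  by unfold_locales auto

lemma H1_norm_minus_commute:
  assumes "u \<in> H1p" "v \<in> H1p"
  shows "H1_norm (\<lambda>x. u x - v x) = H1_norm (\<lambda>x. v x - u x)"
  using assms
  by (intro antisym H1_norm_mono H1p_diff) (simp_all add: fourier_diff H1p_L2 norm_minus_commute)

lemma H1_norm_triangle:
  assumes u: "u \<in> H1p" and v: "v \<in> H1p"
  shows "H1_norm (\<lambda>x. u x + v x) \<le> H1_norm u + H1_norm v"
proof (rule power2_le_imp_le)
  let ?i = "bilin (\<lambda>_. 1) (\<lambda>_. 1)"
  have self: "Re (?i w w) = (H1_norm w)\<^sup>2" if "w \<in> H1p" for w :: "real ^ 'a \<Rightarrow> complex"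
    using sobolev.bilin_self_bounds[OF that] that by (simp add: H1_norm_sq)
  have "(H1_norm (\<lambda>x. u x + v x))\<^sup>2 = (H1_norm u)\<^sup>2 + 2 * Re (?i u v) + (H1_norm v)\<^sup>2"
    using u v sobolev.bilin_cnj[OF u v]
    by (simp add: self[symmetric] H1p_add sobolev.bilin_add_left sobolev.bilin_add_right)
  also have "Re (?i u v) \<le> H1_norm u * H1_norm v"
    using sobolev.bilin_bounded[OF u v] complex_Re_le_cmod[of "?i u v"] by simp
  finally show "(H1_norm (\<lambda>x. u x + v x))\<^sup>2 \<le> (H1_norm u + H1_norm v)\<^sup>2"
    by (simp add: power2_sum)
  show "0 \<le> H1_norm u + H1_norm v"
    using u v by (simp add: H1_norm_nonneg)
qed


section \<open>The residual controls the error\<close>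

context elliptic
begin

lemma bilin_trig_poly_right:
  assumes x: "x \<in> H1p" and F: "finite F"
  shows "bilin \<nu> \<sigma> x (trig_poly c F) = (\<Sum>k\<in>F. cnj (c k) * bilin \<nu> \<sigma> x (phi k))"
  using F
proof (induction F)
  case empty
  have "bilin \<nu> \<sigma> x (\<lambda>t. 0 * 0) = cnj 0 * bilin \<nu> \<sigma> x (\<lambda>t. 0)"
    using trig_poly_in_H1p[of c "{}"] x by (intro bilin_cmult_right) (simp_all add: trig_poly_def[abs_def])
  then show ?case
    by (simp add: trig_poly_def[abs_def])
next
  case (insert k F)
  have "trig_poly c (insert k F) = (\<lambda>t. c k * phi k t + trig_poly c F t)"
    using insert by (simp add: trig_poly_def fun_eq_iff)
  moreover have "phi k \<in> H1p"
    using trig_span_phi[of k UNIV] trig_span_in_H1p by blast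
  ultimately show ?case
    using insert x by (simp add: bilin_add_right bilin_cmult_right H1p_cmult trig_poly_in_H1p)
qed

text \<open>
  Testing with the Riesz representative of the truncated functional bounds the partial sums of
  the dual norm; without this summability the dual norm would be the default value of a divergent
  sum.
\<close>

lemma dual_partial_sum_le:
  assumes x: "x \<in> H1p" and r: "\<And>v. v \<in> H1p \<Longrightarrow> r v = bilin \<nu> \<sigma> x v" and F: "finite F"
  shows "(\<Sum>k\<in>F. (cmod (dual_fourier r k))\<^sup>2 / (1 + (norm (freq k))\<^sup>2)) \<le> (hi * H1_norm x)\<^sup>2"
proof -
  define w where "w k = 1 + (norm (freq k))\<^sup>2" for k :: "int ^ 'd"
  have w: "w k > 0" for k
    by (simp add: w_def add_pos_nonneg)
  define S where "S = (\<Sum>k\<in>F. (cmod (dual_fourier r k))\<^sup>2 / w k)"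
  define z where "z = trig_poly (\<lambda>k. dual_fourier r k / of_real (w k)) F"
  have z: "z \<in> H1p"
    by (simp add: z_def trig_poly_in_H1p)
  have "phi k \<in> H1p" for k :: "int ^ 'd"
    using trig_span_phi[of k UNIV] trig_span_in_H1p by blast
  then have rk: "bilin \<nu> \<sigma> x (phi k) = dual_fourier r k" for k
    by (simp add: dual_fourier_def r)
  have "bilin \<nu> \<sigma> x z = (\<Sum>k\<in>F. of_real ((cmod (dual_fourier r k))\<^sup>2 / w k))"
    unfolding z_def bilin_trig_poly_right[OF x F] rk
    by (intro sum.cong refl) (simp add: complex_norm_square mult.commute del: of_real_power)
  then have S: "bilin \<nu> \<sigma> x z = of_real S"
    by (simp add: S_def)
  have "h1sq z = S"
    unfolding z_def h1sq_trig_poly[OF F] S_def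
  proof (intro sum.cong refl)
    fix k
    show "(1 + (norm (freq k))\<^sup>2) * (cmod (dual_fourier r k / of_real (w k)))\<^sup>2 = (cmod (dual_fourier r k))\<^sup>2 / w k"
      using w[of k] unfolding w_def[symmetric]
      by (simp add: norm_divide power_divide power2_eq_square[of "w k"])
  qed
  then have zS: "H1_norm z = sqrt S"
    using z by (simp add: H1_norm_eq)
  have "S \<ge> 0"
    using w by (simp add: S_def sum_nonneg less_imp_le)
  have "S \<le> hi * H1_norm x * sqrt S"
    using bilin_bounded[OF x z] \<open>S \<ge> 0\<close> by (simp add: S zS)
  then have "sqrt S * sqrt S \<le> hi * H1_norm x * sqrt S"
    using \<open>S \<ge> 0\<close> by simp
  moreover have "0 \<le> hi * H1_norm x"
    using lo_pos lo_le_hi x by (auto intro!: mult_nonneg_nonneg H1_norm_nonneg)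
  ultimately have "sqrt S \<le> hi * H1_norm x"
    using \<open>S \<ge> 0\<close> mult_right_le_imp_le[of "sqrt S" "sqrt S" "hi * H1_norm x"] by (cases "S = 0") auto
  then have "(sqrt S)\<^sup>2 \<le> (hi * H1_norm x)\<^sup>2"
    using \<open>S \<ge> 0\<close> by (intro power_mono) auto
  then show ?thesis
    using \<open>S \<ge> 0\<close> by (simp add: S_def w_def)
qed

text \<open>
  For trigonometric polynomials this is the Cauchy-Schwarz inequality for sums; the remaining tail
  of \<open>v\<close> is small in norm and the form is continuous.
\<close>

lemma bilin_le_dual_norm:
  assumes x: "x \<in> H1p" and r: "\<And>v. v \<in> H1p \<Longrightarrow> r v = bilin \<nu> \<sigma> x v" and v: "v \<in> H1p"
  shows "cmod (bilin \<nu> \<sigma> x v) \<le> Hm1_norm r * H1_norm v"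
proof (rule field_le_epsilon)
  fix e :: real assume "e > 0"
  define w where "w k = 1 + (norm (freq k))\<^sup>2" for k :: "int ^ 'd"
  have w: "w k > 0" for k
    by (simp add: w_def add_pos_nonneg)
  define R where "R = hi * H1_norm x"
  have R: "R \<ge> 0"
    unfolding R_def using lo_pos lo_le_hi x by (auto intro!: mult_nonneg_nonneg H1_norm_nonneg)
  \<comment> \<open>the form maps a tail of norm below \<open>e / (R + 1)\<close> to a value of at most \<open>e\<close>\<close>
  have "e / (R + 1) > 0"
    using \<open>e > 0\<close> R by simp
  then obtain F where F: "finite F" "H1_norm (\<lambda>t. v t - proj F v t) < e / (R + 1)"
    using H1_norm_diff_proj_small[OF v] by blast
  let ?g = "\<lambda>k. (cmod (dual_fourier r k))\<^sup>2 / w k"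
  have "?g summable_on UNIV"
  proof (rule nonneg_bdd_above_summable_on)
    show "bdd_above (sum ?g ` {F. F \<subseteq> UNIV \<and> finite F})"
      using dual_partial_sum_le[OF x r] unfolding w_def by (intro bdd_aboveI2) blast
  qed (use w in \<open>simp add: less_imp_le\<close>)
  then have "sum ?g F \<le> infsum ?g UNIV"
    using F(1) w by (intro finite_sum_le_infsum) (auto simp: less_imp_le)
  then have dual: "sqrt (sum ?g F) \<le> Hm1_norm r"
    by (simp add: Hm1_norm_def w_def)
  have "(\<Sum>k\<in>F. w k * (cmod (fourier v k))\<^sup>2) \<le> h1sq v"
    using h1sq_diff_proj[OF v F(1)] h1sq_nonneg[of "\<lambda>x. v x - proj F v x"] by (simp add: w_def)
  then have primal: "sqrt (\<Sum>k\<in>F. w k * (cmod (fourier v k))\<^sup>2) \<le> H1_norm v"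
    using v by (simp add: H1_norm_eq)
  have "phi k \<in> H1p" for k :: "int ^ 'd"
    using trig_span_phi[of k UNIV] trig_span_in_H1p by blast
  then have rk: "bilin \<nu> \<sigma> x (phi k) = dual_fourier r k" for k
    by (simp add: dual_fourier_def r)
  have "cmod (bilin \<nu> \<sigma> x (proj F v)) \<le> (\<Sum>k\<in>F. cmod (cnj (fourier v k) * dual_fourier r k))"
    unfolding proj_eq bilin_trig_poly_right[OF x F(1)] rk
    by (rule norm_sum)
  also have "\<dots> = (\<Sum>k\<in>F. \<bar>cmod (dual_fourier r k) / sqrt (w k)\<bar> * \<bar>sqrt (w k) * cmod (fourier v k)\<bar>)"
    using w by (intro sum.cong refl) (simp add: norm_mult abs_mult less_imp_le less_imp_neq[symmetric])
  also have "\<dots> \<le> L2_set (\<lambda>k. cmod (dual_fourier r k) / sqrt (w k)) F * L2_set (\<lambda>k. sqrt (w k) * cmod (fourier v k)) F"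
    by (rule L2_set_mult_ineq)
  also have "\<dots> = sqrt (sum ?g F) * sqrt (\<Sum>k\<in>F. w k * (cmod (fourier v k))\<^sup>2)"
    using w by (simp add: L2_set_def power_divide power_mult_distrib less_imp_le)
  also have "\<dots> \<le> Hm1_norm r * H1_norm v"
    using dual primal w
    by (intro mult_mono) (auto intro!: order_trans[OF _ dual] real_sqrt_ge_zero sum_nonneg simp: less_imp_le)
  finally have main: "cmod (bilin \<nu> \<sigma> x (proj F v)) \<le> Hm1_norm r * H1_norm v" .
  have tail: "cmod (bilin \<nu> \<sigma> x (\<lambda>t. v t - proj F v t)) \<le> e"
  proof -
    have "cmod (bilin \<nu> \<sigma> x (\<lambda>t. v t - proj F v t)) \<le> R * H1_norm (\<lambda>t. v t - proj F v t)"
      unfolding R_def using x v by (intro bilin_bounded H1p_diff proj_in_H1p)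
    also have "\<dots> \<le> R * (e / (R + 1))"
      using F(2) R by (intro mult_left_mono) auto
    also have "\<dots> \<le> e"
      using R \<open>e > 0\<close> by (simp add: field_simps)
    finally show ?thesis .
  qed
  have "bilin \<nu> \<sigma> x v = bilin \<nu> \<sigma> x (proj F v) + bilin \<nu> \<sigma> x (\<lambda>t. v t - proj F v t)"
    using x v by (simp add: bilin_diff_right proj_in_H1p)
  then show "cmod (bilin \<nu> \<sigma> x v) \<le> Hm1_norm r * H1_norm v + e"
    using main tail norm_triangle_ineq[of "bilin \<nu> \<sigma> x (proj F v)" "bilin \<nu> \<sigma> x (\<lambda>t. v t - proj F v t)"]
    by simp
qed

text \<open>
  The residual of \<open>w\<close> is the functional \<open>a(u - w, \<cdot>)\<close>; testing it with \<open>u - w\<close> and using coercivity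
  cancels one factor \<open>\<parallel>u - w\<parallel>\<close>. In particular the input condition of the coarsening step holds.
\<close>

lemma error_le_residual:
  assumes u: "weak_solution \<nu> \<sigma> f u" and w: "w \<in> H1p"
  shows "H1_norm (\<lambda>x. u x - w x) \<le> 1 / lo * Hm1_norm (residual \<nu> \<sigma> f w)"
proof -
  let ?x = "\<lambda>x. u x - w x" and ?r = "residual \<nu> \<sigma> f w"
  have uH: "u \<in> H1p" and uf: "\<And>v. v \<in> H1p \<Longrightarrow> bilin \<nu> \<sigma> u v = f v"
    using u by (auto simp: weak_solution_def)
  have x: "?x \<in> H1p"
    using uH w by (rule H1p_diff)
  have "?r v = bilin \<nu> \<sigma> ?x v" if "v \<in> H1p" for v
    using that uH w by (simp add: residual_def oper_def uf bilin_diff_left)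
  then have "cmod (bilin \<nu> \<sigma> ?x ?x) \<le> Hm1_norm ?r * H1_norm ?x"
    using x by (intro bilin_le_dual_norm) auto
  moreover have "lo * (H1_norm ?x)\<^sup>2 \<le> cmod (bilin \<nu> \<sigma> ?x ?x)"
    using bilin_self_bounds(1)[OF x] complex_Re_le_cmod[of "bilin \<nu> \<sigma> ?x ?x"] by (simp add: H1_norm_sq x)
  ultimately have le: "(lo * H1_norm ?x) * H1_norm ?x \<le> Hm1_norm ?r * H1_norm ?x"
    by (simp add: power2_eq_square mult.assoc)
  show ?thesis
  proof (cases "H1_norm ?x = 0")
    case True
    have "0 \<le> Hm1_norm ?r"
      unfolding Hm1_norm_def by (intro real_sqrt_ge_zero infsum_nonneg) (simp add: add_nonneg_nonneg)
    then show ?thesis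
      using True lo_pos by simp
  next
    case False
    then have "H1_norm ?x > 0"
      using H1_norm_nonneg[OF x] by simp
    then have "lo * H1_norm ?x \<le> Hm1_norm ?r"
      using le by simp
    then show ?thesis
      using lo_pos by (simp add: field_simps)
  qed
qed

end

section \<open>Coarsening\<close>

lemma fourier_trig_span_outside:
  assumes "w \<in> trig_span \<Lambda>" "k \<notin> \<Lambda>"
  shows "fourier w k = 0"
  using assms by (auto simp: trig_span_iff fourier_trig_poly)

text \<open>
  A set of \<open>N\<close> frequencies that is good for \<open>u\<close> competes with the output of the coarsening step,
  after discarding the frequencies at which \<open>w\<close> has no coefficient anyway. The strict inequality
  provides such a set although the infimum in the best error need not be attained.
\<close>

lemma coarse_card_le:
  fixes u :: "real ^ 'd::finite \<Rightarrow> complex"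
  assumes u: "u \<in> H1p" and w: "w \<in> trig_span \<Lambda>s" and close: "H1_norm (\<lambda>x. u x - w x) \<le> \<epsilon>"
    and coarse: "coarse \<Lambda>s w \<epsilon> \<Lambda>" and best: "best_err N u < \<epsilon>"
  shows "card \<Lambda> \<le> N"
proof -
  let ?S = "{\<Lambda> :: (int ^ 'd) set. finite \<Lambda> \<and> card \<Lambda> = N}"
  have "inj (\<lambda>n. axis undefined (int n) :: int ^ 'd)"
    by (auto simp: inj_def axis_eq_axis)
  then have "infinite (UNIV :: (int ^ 'd) set)"
    by (meson finite_imageD finite_subset infinite_UNIV_nat subset_UNIV)
  then obtain \<Lambda>0 :: "(int ^ 'd) set" where "finite \<Lambda>0" "card \<Lambda>0 = N"
    using infinite_arbitrarily_large by blast
  then have "?S \<noteq> {}"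
    by blast
  moreover have "bdd_below ((\<lambda>\<Lambda>. H1_norm (\<lambda>x. u x - proj \<Lambda> u x)) ` ?S)"
    using u by (intro bdd_belowI2[where m = 0] H1_norm_nonneg H1p_diff proj_in_H1p)
  ultimately obtain M where M: "finite M" "card M = N" "H1_norm (\<lambda>x. u x - proj M u x) < \<epsilon>"
    using best unfolding best_err_def by (subst (asm) cINF_less_iff) auto
  have wH: "w \<in> H1p"
    using w by (rule trig_span_in_H1p)
  have "finite \<Lambda>s"
    using coarse by (simp add: coarse_def)
  have "proj (M \<inter> \<Lambda>s) w = proj M w"
  proof
    fix x
    show "proj (M \<inter> \<Lambda>s) w x = proj M w x"
      unfolding proj_def
      by (rule sum.mono_neutral_left) (auto simp: M(1) fourier_trig_span_outside[OF w])
  qed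
  then have "H1_norm (\<lambda>x. w x - proj (M \<inter> \<Lambda>s) w x) = H1_norm (\<lambda>x. w x - proj M w x)"
    by simp
  also have "(\<lambda>x. w x - proj M w x) =
      (\<lambda>x. ((w x - u x) - proj M (\<lambda>x. w x - u x) x) + (u x - proj M u x))"
    using wH u by (simp add: proj_def fourier_diff H1p_L2 left_diff_distrib sum_subtractf)
  also have "H1_norm \<dots> \<le> H1_norm (\<lambda>x. (w x - u x) - proj M (\<lambda>x. w x - u x) x) +
      H1_norm (\<lambda>x. u x - proj M u x)"
    using wH u by (intro H1_norm_triangle H1p_diff proj_in_H1p)
  also have "\<dots> \<le> H1_norm (\<lambda>x. w x - u x) + \<epsilon>"
    using wH u M by (intro add_mono H1_norm_diff_proj_le H1p_diff) auto
  also have "\<dots> \<le> 2 * \<epsilon>"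
    using close H1_norm_minus_commute[OF wH u] by simp
  finally have "card \<Lambda> \<le> card (M \<inter> \<Lambda>s)"
    using coarse unfolding coarse_def by blast
  also have "\<dots> \<le> N"
    using M by (metis card_mono inf_le1)
  finally show ?thesis .
qed

text \<open>
  The factor \<open>3\<close> is \<open>1\<close> for the distance from \<open>u\<close> to \<open>w\<close> plus \<open>2\<close> for the coarsening of \<open>w\<close>.
\<close>

lemma (in elliptic) coarse_error_le:
  assumes sol: "weak_solution \<nu> \<sigma> f u" and w: "w \<in> trig_span \<Lambda>s"
    and close: "H1_norm (\<lambda>x. u x - w x) \<le> \<epsilon>"
    and coarse: "coarse \<Lambda>s w \<epsilon> \<Lambda>" and gal: "galerkin \<nu> \<sigma> f \<Lambda> u'"
  shows "H1_norm (\<lambda>x. u x - u' x) \<le> 3 * sqrt (hi / lo) * \<epsilon>"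
proof -
  have u: "u \<in> H1p"
    using sol by (simp add: weak_solution_def)
  have wH: "w \<in> H1p"
    using w by (rule trig_span_in_H1p)
  have fin: "finite \<Lambda>"
    using coarse finite_subset unfolding coarse_def by blast
  have z: "proj \<Lambda> w \<in> trig_span \<Lambda>"
    using fin by (simp add: proj_eq trig_poly_in_trig_span)
  have "H1_norm (\<lambda>x. u x - proj \<Lambda> w x) = H1_norm (\<lambda>x. (u x - w x) + (w x - proj \<Lambda> w x))"
    by simp
  also have "\<dots> \<le> H1_norm (\<lambda>x. u x - w x) + H1_norm (\<lambda>x. w x - proj \<Lambda> w x)"
    using u wH by (intro H1_norm_triangle H1p_diff proj_in_H1p)
  also have "\<dots> \<le> 3 * \<epsilon>"
    using close coarse by (simp add: coarse_def)
  finally have best: "H1_norm (\<lambda>x. u x - proj \<Lambda> w x) \<le> 3 * \<epsilon>" .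
  have "H1_norm (\<lambda>x. u x - u' x) \<le> sqrt (hi / lo) * H1_norm (\<lambda>x. u x - proj \<Lambda> w x)"
    using galerkin_quasi_optimal[OF sol gal z] .
  also have "\<dots> \<le> sqrt (hi / lo) * (3 * \<epsilon>)"
    using best lo_pos lo_le_hi by (intro mult_left_mono) auto
  finally show ?thesis
    by simp
qed


section \<open>The exponential class\<close>

lemma omega_pos: "omega TYPE('d::finite) > 0"
  unfolding omega_def by (simp add: measure_completion content_ball_pos)

lemma best_err_0: "best_err 0 u = H1_norm u"
proof -
  have "{\<Lambda> :: (int ^ 'a) set. finite \<Lambda> \<and> card \<Lambda> = 0} = {{}}"
    by auto
  then show ?thesis
    by (simp add: best_err_def proj_def)
qed

lemma best_err_le:
  fixes u :: "real ^ 'd::finite \<Rightarrow> complex"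
  assumes "u \<in> AG \<eta> t"
  shows "best_err N u \<le> AG_norm \<eta> t u *
    exp (- (\<eta> * omega TYPE('d) powr (- t / real CARD('d)) * real N powr (t / real CARD('d))))"
proof -
  have "weighted_err \<eta> t u N \<le> AG_norm \<eta> t u"
    using assms unfolding AG_def AG_norm_def by (auto intro: cSUP_upper)
  then show ?thesis
    by (simp add: weighted_err_def exp_minus field_simps)
qed

lemma H1_norm_le_AG_norm:
  assumes "u \<in> AG \<eta> t"
  shows "H1_norm u \<le> AG_norm \<eta> t u"
  using best_err_le[OF assms, of 0] by (simp add: best_err_0)

text \<open>
  Solving the decay estimate for the number of terms. Rounding up, to an integer strictly beyond
  the critical value, costs the additive \<open>1\<close> and makes the error strictly smaller than the
  tolerance.
\<close>

lemma AG_number_of_terms: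
  fixes u :: "real ^ 'd::finite \<Rightarrow> complex"
  assumes u: "u \<in> AG \<eta> t" and \<eta>: "\<eta> > 0" and t: "t > 0"
    and A: "AG_norm \<eta> t u > 0" and Y: "Y \<ge> 0"
  shows "\<exists>N. best_err N u < AG_norm \<eta> t u * exp (- Y) \<and>
    real N \<le> omega TYPE('d) / \<eta> powr (real CARD('d) / t) * Y powr (real CARD('d) / t) + 1"
proof -
  define p where "p = real CARD('d) / t"
  have p: "p > 0" "t / real CARD('d) = 1 / p" "- t / real CARD('d) = - (1 / p)"
    using t by (simp_all add: p_def)
  define X where "X = omega TYPE('d) / \<eta> powr p * Y powr p"
  have X: "X \<ge> 0"
    using omega_pos[where 'd = 'd] by (simp add: X_def)
  define N where "N = nat \<lfloor>X\<rfloor> + 1"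
  have N: "X < real N" "real N \<le> X + 1"
    using X by (simp_all add: N_def) linarith+
  have "\<eta> * omega TYPE('d) powr (- (1 / p)) * X powr (1 / p) = Y"
  proof -
    have "X powr (1 / p) = omega TYPE('d) powr (1 / p) / \<eta> * Y"
      using omega_pos[where 'd = 'd] p(1) \<eta> Y
      by (simp add: X_def powr_mult powr_divide powr_powr)
    moreover have "omega TYPE('d) powr (- (1 / p)) * omega TYPE('d) powr (1 / p) = 1"
      using omega_pos[where 'd = 'd] by (simp flip: powr_add)
    moreover have "\<eta> * a * (b / \<eta> * Y) = (a * b) * Y" for a b
      using \<eta> by simp
    ultimately show ?thesis
      by simp
  qed
  moreover have "X powr (1 / p) < real N powr (1 / p)"
    using X N(1) p(1) by (intro powr_less_mono2) auto
  ultimately have "Y < \<eta> * omega TYPE('d) powr (- (1 / p)) * real N powr (1 / p)"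
    using omega_pos[where 'd = 'd] \<eta> by (metis mult_strict_left_mono mult_pos_pos powr_gt_zero less_irrefl)
  then have "AG_norm \<eta> t u * exp (- (\<eta> * omega TYPE('d) powr (- (1 / p)) * real N powr (1 / p))) <
      AG_norm \<eta> t u * exp (- Y)"
    using A by simp
  then have "best_err N u < AG_norm \<eta> t u * exp (- Y)"
    using best_err_le[OF u, of N] unfolding p by linarith
  then show ?thesis
    using N(2) unfolding X_def p_def by blast
qed

text \<open>The slack \<open>\<kappa> - 1\<close> in the factor pays for the additive \<open>1\<close> once the logarithm is shifted by \<open>s\<close>.\<close>

lemma shift_absorbs_one:
  fixes K p \<kappa> :: real
  assumes "K > 0" "p > 0" "\<kappa> > 1"
  obtains s where "s > 0" "\<And>Y. Y \<ge> 0 \<Longrightarrow> K * Y powr p + 1 \<le> \<kappa> * K * (Y + s) powr p"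
proof
  define s where "s = (1 / ((\<kappa> - 1) * K)) powr (1 / p)"
  show "s > 0"
    using assms by (simp add: s_def)
  have sp: "s powr p = 1 / ((\<kappa> - 1) * K)"
    using assms by (simp add: s_def powr_powr)
  show "K * Y powr p + 1 \<le> \<kappa> * K * (Y + s) powr p" if "Y \<ge> 0" for Y
  proof -
    have "K * Y powr p \<le> K * (Y + s) powr p"
      using assms that \<open>s > 0\<close> by (intro mult_left_mono powr_mono2) auto
    moreover have "(\<kappa> - 1) * K * s powr p \<le> (\<kappa> - 1) * K * (Y + s) powr p"
      using assms that \<open>s > 0\<close> by (intro mult_left_mono powr_mono2) auto
    moreover have "(\<kappa> - 1) * K * s powr p = 1"
      using assms by (simp add: sp)
    ultimately show ?thesis
      by (simp add: algebra_simps)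
  qed
qed


section \<open>The cardinality bound\<close>

text \<open>
  The bound before the additive \<open>1\<close> is absorbed. Comparing the Galerkin solution with \<open>0\<close> bounds the
  error by a multiple of \<open>\<parallel>u\<parallel>\<close>, and this is what keeps the logarithm nonnegative.
\<close>

lemma (in elliptic) cadfour_bounds:
  fixes u :: "real ^ 'd \<Rightarrow> complex"
  assumes sol: "weak_solution \<nu> \<sigma> f u" and u: "u \<in> AG \<eta> t" and \<eta>: "\<eta> > 0" and t: "t > 0"
    and run: "cadfour \<nu> \<sigma> f lo \<theta> tol n \<Lambda>n un" and e: "H1_norm (\<lambda>x. u x - un x) \<noteq> 0"
  defines "Y \<equiv> ln (AG_norm \<eta> t u / H1_norm (\<lambda>x. u x - un x)) + ln (3 * sqrt (hi / lo))"
  shows "0 \<le> Y \<and>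
    real (card \<Lambda>n) \<le> omega TYPE('d) / \<eta> powr (real CARD('d) / t) * Y powr (real CARD('d) / t) + 1"
proof -
  define q where "q = sqrt (hi / lo)"
  define e where "e = H1_norm (\<lambda>x. u x - un x)"
  define A where "A = AG_norm \<eta> t u"
  have q: "q \<ge> 1"
    using lo_pos lo_le_hi by (simp add: q_def)
  have uH: "u \<in> H1p"
    using u by (simp add: AG_def)
  have unH: "un \<in> H1p"
    using run
  proof cases
    case start
    then show ?thesis
      using trig_span_in_H1p trig_span_zero by blast
  next
    case pass
    then show ?thesis
      using trig_span_in_H1p by (auto simp: galerkin_def)
  qed
  have e_pos: "e > 0"
    using e H1_norm_nonneg[OF H1p_diff[OF uH unH]] by (simp add: e_def)
  have "e \<le> q * H1_norm u"
    using run
  proof cases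
    case start
    then show ?thesis
      using q H1_norm_nonneg[OF uH] mult_right_mono[of 1 q "H1_norm u"] by (simp add: e_def)
  next
    case (pass n \<Lambda>n' un' k \<Lambda>s w)
    then show ?thesis
      using galerkin_quasi_optimal[OF sol _ trig_span_zero] by (auto simp: e_def q_def)
  qed
  also have "\<dots> \<le> q * A"
    using q H1_norm_le_AG_norm[OF u] by (intro mult_left_mono) (auto simp: A_def)
  finally have eA: "e \<le> q * A" .
  have A: "A > 0"
    using eA e_pos q by (metis less_le_trans mult_nonneg_nonpos not_less order_trans zero_le_one)
  have expY: "A * exp (- Y) = e / (3 * q)"
  proof -
    have "Y = ln (A / e * (3 * q))"
      unfolding Y_def e_def[symmetric] A_def[symmetric] q_def[symmetric]
      using A e_pos q by (subst ln_mult) auto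
    then have "exp (- Y) = inverse (A / e * (3 * q))"
      using A e_pos q by (simp add: exp_minus)
    then show ?thesis
      using A by (simp add: field_simps)
  qed
  have Y: "0 \<le> Y"
  proof -
    have "A * exp (- Y) \<le> A * 1"
      unfolding expY using eA q A e_pos by (simp add: field_simps)
    then show ?thesis
      using A by simp
  qed
  moreover have "real (card \<Lambda>n) \<le>
      omega TYPE('d) / \<eta> powr (real CARD('d) / t) * Y powr (real CARD('d) / t) + 1"
    using run
  proof cases
    case start
    then show ?thesis
      using omega_pos[where 'd = 'd] by simp
  next
    case (pass n \<Lambda>n' un' k \<Lambda>s w)
    let ?\<epsilon> = "1 / lo * Hm1_norm (residual \<nu> \<sigma> f w)"
    have w: "w \<in> trig_span \<Lambda>s"
      using pass(4) by cases (auto simp: galerkin_def)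
    have close: "H1_norm (\<lambda>x. u x - w x) \<le> ?\<epsilon>"
      using sol trig_span_in_H1p[OF w] by (rule error_le_residual)
    have "e \<le> 3 * q * ?\<epsilon>"
      unfolding e_def q_def using sol w close pass(6,7) by (rule coarse_error_le)
    then have "A * exp (- Y) \<le> ?\<epsilon>"
      unfolding expY using q by (simp add: field_simps)
    moreover obtain N where "best_err N u < A * exp (- Y)"
      and N: "real N \<le> omega TYPE('d) / \<eta> powr (real CARD('d) / t) * Y powr (real CARD('d) / t) + 1"
      using AG_number_of_terms[OF u \<eta> t _ Y] A unfolding A_def by blast
    ultimately have "card \<Lambda>n \<le> N"
      using coarse_card_le[OF uH w close pass(6)] by simp
    then show ?thesis
      using N by linarith
  qed
  ultimately show ?thesis
    by blast
qed

theorem theorem8p1: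
  fixes \<nu> \<sigma> :: "real ^ 'd::finite \<Rightarrow> real"
    and \<nu>_lo \<nu>_hi \<sigma>_lo \<sigma>_hi \<eta> t \<kappa> :: real
  assumes "periodic \<nu>" and "C_k 1 \<nu>"
    and "periodic \<sigma>" and "C_k 1 \<sigma>"
    and "0 < \<nu>_lo" and "\<And>x. \<nu>_lo \<le> \<nu> x \<and> \<nu> x \<le> \<nu>_hi"
    and "0 < \<sigma>_lo" and "\<And>x. \<sigma>_lo \<le> \<sigma> x \<and> \<sigma> x \<le> \<sigma>_hi"
    and "\<eta> > 0" and "0 < t" and "t \<le> real CARD('d)"
    and "\<kappa> > 1"
  shows "\<exists>C>1. \<forall>f u \<theta> tol.
           f \<in> Hm1p \<longrightarrow> weak_solution \<nu> \<sigma> f u \<longrightarrow> u \<in> AG \<eta> t \<longrightarrow>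
           0 < \<theta> \<longrightarrow> \<theta> < 1 \<longrightarrow> 0 \<le> tol \<longrightarrow> tol < 1 \<longrightarrow>
           (\<forall>n \<Lambda>n un. cadfour \<nu> \<sigma> f (min \<nu>_lo \<sigma>_lo) \<theta> tol n \<Lambda>n un \<longrightarrow>
              H1_norm (\<lambda>x. u x - un x) \<noteq> 0 \<longrightarrow>
              0 \<le> ln (AG_norm \<eta> t u / H1_norm (\<lambda>x. u x - un x)) + ln C \<and>
              real (card \<Lambda>n) \<le>
                \<kappa> * (omega TYPE('d) / \<eta> powr (real CARD('d) / t)) *
                (ln (AG_norm \<eta> t u / H1_norm (\<lambda>x. u x - un x)) + ln C) powr (real CARD('d) / t))"
proof -
  let ?lo = "min \<nu>_lo \<sigma>_lo" and ?hi = "max \<nu>_hi \<sigma>_hi"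
  let ?K = "omega TYPE('d) / \<eta> powr (real CARD('d) / t)"
  interpret elliptic \<nu> \<sigma> ?lo ?hi
  proof
    have "\<And>x. \<nu> differentiable at x" "\<And>x. \<sigma> differentiable at x"
      using assms(2,4) by simp_all
    then show "continuous_on UNIV \<nu>" "continuous_on UNIV \<sigma>"
      by (simp_all add: continuous_at_imp_continuous_on differentiable_imp_continuous_within)
    show "?lo \<le> \<nu> x" "\<nu> x \<le> ?hi" "?lo \<le> \<sigma> x" "\<sigma> x \<le> ?hi" for x
      using assms(6)[of x] assms(8)[of x] by auto
  qed (use assms in auto)
  have "?K > 0" "real CARD('d) / t > 0"
    using assms omega_pos[where 'd = 'd] by simp_all
  then obtain s where s: "s > 0"
    "\<And>Y. Y \<ge> 0 \<Longrightarrow> ?K * Y powr (real CARD('d) / t) + 1 \<le> \<kappa> * ?K * (Y + s) powr (real CARD('d) / t)"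
    using shift_absorbs_one[OF _ _ \<open>\<kappa> > 1\<close>] by metis
  let ?q = "sqrt (?hi / ?lo)"
  have q: "?q \<ge> 1"
    using lo_pos lo_le_hi by simp
  have C: "3 * ?q * exp s > 1"
  proof -
    have "1 < 3 * ?q" "1 < exp s"
      using q s(1) by (linarith, simp)
    then show ?thesis
      by (rule less_1_mult)
  qed
  have lnC: "ln (3 * ?q * exp s) = ln (3 * ?q) + s"
  proof -
    have "3 * ?q \<noteq> 0"
      using q by linarith
    then show ?thesis
      unfolding ln_mult by (simp only: ln_exp exp_not_eq_zero simp_thms if_True)
  qed
  show ?thesis
  proof (intro exI[of _ "3 * ?q * exp s"] conjI C allI impI)
    fix f u \<theta> tol n \<Lambda>n un
    assume sol: "weak_solution \<nu> \<sigma> f u" and u: "u \<in> AG \<eta> t"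
      and run: "cadfour \<nu> \<sigma> f ?lo \<theta> tol n \<Lambda>n un" and e: "H1_norm (\<lambda>x. u x - un x) \<noteq> 0"
    let ?Y = "ln (AG_norm \<eta> t u / H1_norm (\<lambda>x. u x - un x)) + ln (3 * ?q)"
    have Y: "0 \<le> ?Y" "real (card \<Lambda>n) \<le> ?K * ?Y powr (real CARD('d) / t) + 1"
      using cadfour_bounds[OF sol u \<open>\<eta> > 0\<close> \<open>0 < t\<close> run e] by blast+
    show "0 \<le> ln (AG_norm \<eta> t u / H1_norm (\<lambda>x. u x - un x)) + ln (3 * ?q * exp s)"
      unfolding lnC using Y(1) s(1) by linarith
    show "real (card \<Lambda>n) \<le> \<kappa> * ?K *
        (ln (AG_norm \<eta> t u / H1_norm (\<lambda>x. u x - un x)) + ln (3 * ?q * exp s)) powr (real CARD('d) / t)"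
      unfolding lnC add.assoc[symmetric] using Y(2) s(2)[OF Y(1)] by (rule order_trans)
  qed
qed

end
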